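(* Let $m_1=2$, $m_2=3$, $k=49$, $l_1=2$, $l_2=1$. Let $\Lambda_1,\Lambda_2$ be the $sl_3$ weights with $(\Lambda_1,\alpha_1)=2$, $(\Lambda_1,\alpha_2)=3$, $(\Lambda_2,\alpha_1)=49$, $(\Lambda_2,\alpha_2)=0$, and let $\Lambda_\infty=\Lambda_1+\Lambda_2-2\alpha_1-\alpha_2$. Then the multiplicity of $L_{\Lambda_\infty}$ in $L_{\Lambda_1}\otimes L_{\Lambda_2}$ is $1$, and the corresponding Bethe Ansatz equation, i.e. the system $$\frac{2}{t_1}+\frac{49}{t_1-1}-\frac{2}{t_1-t_2}+\frac1{t_1-s}=0,\qquad \frac{2}{t_2}+\frac{49}{t_2-1}-\frac{2}{t_2-t_1}+\frac1{t_2-s}=0,\qquad \frac{3}{s}+\frac1{s-t_1}+\frac1{s-t_2}=0,$$ has no solutions $(t_1,t_2,s)\in\mathbb C^3$ (where a solution must have all denominators non-zero).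
   Context: $\alpha_1,\alpha_2$ are the simple roots of $sl_3$, $(\cdot,\cdot)$ is the invariant scalar product normalized by $(\alpha_i,\alpha_i)=2$, and $L_\Lambda$ is the irreducible $sl_3$-module of highest weight $\Lambda$. The displayed system is the Bethe Ansatz equation of the Gaudin model for $sl_3$, points $z_1=0$, $z_2=1$, weights $\Lambda_1,\Lambda_2$ and numbers of Bethe variables $(l_1,l_2)=(2,1)$. *)

theory Defs
  imports "HOL-Analysis.Analysis"
begin

definition lie_bracket :: "complex^'n^'n \<Rightarrow> complex^'n^'n \<Rightarrow> complex^'n^'n" where
  "lie_bracket A B = A ** B - B ** A"

definition sl3 :: "(complex^3^3) set" where
  "sl3 = {x. trace x = 0}"

(* A finite-dimensional module is given by matrices acting on the column vectors of complex^'n.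
   This loses nothing here: the weights considered are dominant integral, so the irreducible
   modules with these highest weights are finite-dimensional. The product mat c ** x is the
   scalar multiple of x by c. Values of rho outside sl3 are irrelevant. *)
definition sl3_module :: "(complex^3^3 \<Rightarrow> complex^'n^'n) \<Rightarrow> bool" where
  "sl3_module \<rho> \<longleftrightarrow>
     (\<forall>x\<in>sl3. \<forall>y\<in>sl3. \<rho> (x + y) = \<rho> x + \<rho> y) \<and>
     (\<forall>c. \<forall>x\<in>sl3. \<rho> (mat c ** x) = mat c ** \<rho> x) \<and>
     (\<forall>x\<in>sl3. \<forall>y\<in>sl3. \<rho> (lie_bracket x y) = lie_bracket (\<rho> x) (\<rho> y))"

definition submodule :: "(complex^3^3 \<Rightarrow> complex^'n^'n) \<Rightarrow> (complex^'n) set \<Rightarrow> bool" where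
  "submodule \<rho> W \<longleftrightarrow> vec.subspace W \<and> (\<forall>x\<in>sl3. \<forall>w\<in>W. \<rho> x *v w \<in> W)"

definition irreducible_submodule ::
    "(complex^3^3 \<Rightarrow> complex^'n^'n) \<Rightarrow> (complex^'n) set \<Rightarrow> bool" where
  "irreducible_submodule \<rho> W \<longleftrightarrow>
     submodule \<rho> W \<and> W \<noteq> {0} \<and> (\<forall>U. submodule \<rho> U \<and> U \<subseteq> W \<longrightarrow> U = {0} \<or> U = W)"

(* The space of weights (the dual of the Cartan subalgebra of traceless diagonal matrices) is
   realised as the triples with sum zero: such a triple mu sends a diagonal matrix h to
   the sum of the mu_i h_ii. Under this identification the invariant form, normalised so that
   roots have square length 2, is the standard bilinear form (no complex conjugation). *)
definition cartan_dual :: "(complex^3) set" where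
  "cartan_dual = {\<mu>. (\<Sum>i\<in>UNIV. \<mu> $ i) = 0}"

definition cartan :: "(complex^3^3) set" where
  "cartan = {h \<in> sl3. \<forall>i j. i \<noteq> j \<longrightarrow> h $ i $ j = 0}"

definition weight_eval :: "complex^3 \<Rightarrow> complex^3^3 \<Rightarrow> complex" where
  "weight_eval \<mu> h = (\<Sum>i\<in>UNIV. \<mu> $ i * h $ i $ i)"

definition weight_form :: "complex^3 \<Rightarrow> complex^3 \<Rightarrow> complex" where
  "weight_form \<mu> \<nu> = (\<Sum>i\<in>UNIV. \<mu> $ i * \<nu> $ i)"

definition alpha1 :: "complex^3" where "alpha1 = vector [1, -1, 0]"

definition alpha2 :: "complex^3" where "alpha2 = vector [0, 1, -1]"

lemma weight_form_simple_roots: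
  "weight_form alpha1 alpha1 = 2" "weight_form alpha2 alpha2 = 2" "weight_form alpha1 alpha2 = -1"
  by (simp_all add: weight_form_def alpha1_def alpha2_def sum_3)

(* The index type 3 is a quotient of the integers, in which 3 = 0; the order on it is
   therefore not used, and positive root vectors are listed explicitly. *)
definition matrix_unit :: "3 \<Rightarrow> 3 \<Rightarrow> complex^3^3" where
  "matrix_unit i j = (\<chi> k l. if k = i \<and> l = j then 1 else 0)"

definition highest_weight_vector ::
    "(complex^3^3 \<Rightarrow> complex^'n^'n) \<Rightarrow> complex^3 \<Rightarrow> complex^'n \<Rightarrow> bool" where
  "highest_weight_vector \<rho> \<Lambda> v \<longleftrightarrow>
     v \<noteq> 0 \<and>
     (\<forall>h\<in>cartan. \<rho> h *v v = weight_eval \<Lambda> h *s v) \<and>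
     (\<forall>e\<in>{matrix_unit 1 2, matrix_unit 2 3, matrix_unit 1 3}. \<rho> e *v v = 0)"

definition irreducible_highest_weight_module ::
    "(complex^3^3 \<Rightarrow> complex^'n^'n) \<Rightarrow> complex^3 \<Rightarrow> bool" where
  "irreducible_highest_weight_module \<rho> \<Lambda> \<longleftrightarrow>
     sl3_module \<rho> \<and> irreducible_submodule \<rho> UNIV \<and> (\<exists>v. highest_weight_vector \<rho> \<Lambda> v)"

(* The space complex^('n * 'm) is the tensor product of complex^'n and complex^'m, the pure
   tensor of v and w having the entries v_i w_j; x acts by rho x (x) 1 + 1 (x) sigma x. *)
definition tensor_module ::
    "(complex^3^3 \<Rightarrow> complex^'n^'n) \<Rightarrow> (complex^3^3 \<Rightarrow> complex^'m^'m) \<Rightarrow>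
     complex^3^3 \<Rightarrow> complex^('n \<times> 'm)^('n \<times> 'm)" where
  "tensor_module \<rho> \<sigma> x =
     (\<chi> p q. \<rho> x $ fst p $ fst q * mat 1 $ snd p $ snd q
           + mat 1 $ fst p $ fst q * \<sigma> x $ snd p $ snd q)"

lemma tensor_module_pure_tensor:
  fixes \<rho> :: "complex^3^3 \<Rightarrow> complex^'n^'n" and \<sigma> :: "complex^3^3 \<Rightarrow> complex^'m^'m"
  shows "tensor_module \<rho> \<sigma> x *v (\<chi> p. v $ fst p * w $ snd p) =
     (\<chi> p. (\<rho> x *v v) $ fst p * w $ snd p) + (\<chi> p. v $ fst p * (\<sigma> x *v w) $ snd p)"
proof -
  have *: "(\<Sum>q\<in>UNIV. (f (fst q) * mat 1 $ b $ snd q + mat 1 $ a $ fst q * g (snd q))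
              * (v $ fst q * w $ snd q))
         = (\<Sum>i\<in>UNIV. f i * v $ i) * w $ b + v $ a * (\<Sum>j\<in>UNIV. g j * w $ j)"
    for a :: 'n and b :: 'm and f g
  proof -
    have "(\<Sum>q\<in>UNIV. (f (fst q) * mat 1 $ b $ snd q + mat 1 $ a $ fst q * g (snd q))
              * (v $ fst q * w $ snd q))
        = (\<Sum>i\<in>UNIV. \<Sum>j\<in>UNIV. f i * v $ i * (mat 1 $ b $ j * w $ j)
              + mat 1 $ a $ i * v $ i * (g j * w $ j))"
      unfolding UNIV_Times_UNIV[symmetric] sum.cartesian_product
      by (intro sum.cong) (auto simp: algebra_simps)
    also have "\<dots> = (\<Sum>i\<in>UNIV. f i * v $ i) * (\<Sum>j\<in>UNIV. mat 1 $ b $ j * w $ j)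
              + (\<Sum>i\<in>UNIV. mat 1 $ a $ i * v $ i) * (\<Sum>j\<in>UNIV. g j * w $ j)"
      by (simp add: sum.distrib sum_product)
    also have "(\<Sum>j\<in>UNIV. mat 1 $ b $ j * w $ j) = w $ b"
      by (simp add: mat_def if_distrib [of "\<lambda>c. c * _"] cong: if_cong)
    also have "(\<Sum>i\<in>UNIV. mat 1 $ a $ i * v $ i) = v $ a"
      by (simp add: mat_def if_distrib [of "\<lambda>c. c * _"] cong: if_cong)
    finally show ?thesis .
  qed
  show ?thesis
    by (simp add: vec_eq_iff tensor_module_def matrix_vector_mult_def *)
qed

definition isomorphic_to_submodule ::
    "(complex^3^3 \<Rightarrow> complex^'n^'n) \<Rightarrow> (complex^3^3 \<Rightarrow> complex^'m^'m) \<Rightarrow> (complex^'m) set \<Rightarrow> bool"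
  where
  "isomorphic_to_submodule \<rho> \<sigma> W \<longleftrightarrow>
     (\<exists>A :: complex^'n^'m. inj ((*v) A) \<and> range ((*v) A) = W \<and>
        (\<forall>x\<in>sl3. \<forall>v. A *v (\<rho> x *v v) = \<sigma> x *v (A *v v)))"

definition is_direct_sum :: "(complex^'m) set set \<Rightarrow> bool" where
  "is_direct_sum \<W> \<longleftrightarrow>
     finite \<W> \<and> (\<forall>v. \<exists>!u. u \<in> (\<Pi>\<^sub>E W\<in>\<W>. W) \<and> (\<Sum>W\<in>\<W>. u W) = v)"

(* The irreducible module rho occurs n times in a decomposition of sigma into a direct sum of
   irreducible submodules; n does not depend on the decomposition (Krull-Schmidt). A set of
   submodules suffices, as the nonzero summands of an internal direct sum are distinct. *)
definition has_multiplicity ::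
    "(complex^3^3 \<Rightarrow> complex^'n^'n) \<Rightarrow> (complex^3^3 \<Rightarrow> complex^'m^'m) \<Rightarrow> nat \<Rightarrow> bool" where
  "has_multiplicity \<rho> \<sigma> n \<longleftrightarrow>
     (\<exists>\<W>. is_direct_sum \<W> \<and> (\<forall>W\<in>\<W>. irreducible_submodule \<sigma> W) \<and>
        card {W \<in> \<W>. isomorphic_to_submodule \<rho> \<sigma> W} = n)"

end

theory Submission
  imports Defs
begin

text \<open>
  The second assertion is elimination: in the symmetric functions of \<open>t1\<close> and \<open>t2\<close> the system becomes
  polynomial of low degree, and for \<open>s \<noteq> 0\<close> it forces the degenerate configuration \<open>t1 = t2 = s\<close>.

  For the first assertion, write weights in the coordinates \<open>((\<Lambda>, \<alpha>1), (\<Lambda>, \<alpha>2))\<close>, so that the two factors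
  have highest weights \<open>(2, 3)\<close> and \<open>(49, 0)\<close> and the component in question has highest weight \<open>(48, 3)\<close>. Its
  multiplicity is the dimension of the space of vectors of that weight killed by \<open>e1\<close> and \<open>e2\<close>. Let \<open>v\<close> and
  \<open>w\<close> be highest weight vectors of the factors. Evaluating the second factor at the functional dual to \<open>w\<close>
  embeds this space into the space of vectors of the first factor which have weight \<open>\<Lambda>1 - 2 \<alpha>1 - \<alpha>2\<close> and
  are killed by \<open>e2\<close> (\<open>contract_injective\<close>). The weight space is spanned by \<open>f1 f2 f1 v\<close> and \<open>f2 f1 f1 v\<close>, which
  \<open>e2\<close> maps to 4 and 5 times \<open>f1 f1 v \<noteq> 0\<close>. The dimension is therefore at most one (\<open>hwv_unique\<close>), and an
  explicit vector shows that it is one (\<open>hwv_singular_vector\<close>).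

  To pass from this dimension to the multiplicity in a decomposition, three general facts about
  finite-dimensional modules spanned by weight vectors are needed. The submodule generated by a
  highest weight vector is irreducible (\<open>irreducible_gen\<close>): the Casimir operator separates dominant
  weights that differ by a sum of positive roots. An irreducible module is determined up to isomorphism
  by its highest weight (\<open>isomorphic_by_highest_weight\<close>): in the direct sum of two candidates, the pair of
  highest weight vectors generates the graph of an isomorphism. Finally, such a module is a direct sum
  of irreducible submodules (\<open>complete_reducibility\<close>): for a vector of top weight, pair the submodule it
  generates with the submodule of the dual module generated by a dual highest weight vector; both are
  irreducible, and the annihilator of the latter is a complement of the former.
\<close>

section \<open>A root basis and its commutation relations\<close>

definition E1 :: "complex^3^3" where "E1 = matrix_unit 1 2"
definition E2 :: "complex^3^3" where "E2 = matrix_unit 2 3"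
definition E3 :: "complex^3^3" where "E3 = matrix_unit 1 3"
definition F1 :: "complex^3^3" where "F1 = matrix_unit 2 1"
definition F2 :: "complex^3^3" where "F2 = matrix_unit 3 2"
definition F3 :: "complex^3^3" where "F3 = matrix_unit 3 1"
definition H1 :: "complex^3^3" where "H1 = matrix_unit 1 1 - matrix_unit 2 2"
definition H2 :: "complex^3^3" where "H2 = matrix_unit 2 2 - matrix_unit 3 3"

lemmas root_basis_defs = E1_def E2_def E3_def F1_def F2_def F3_def H1_def H2_def

lemma root_basis_in_sl3 [simp]:
  "E1 \<in> sl3" "E2 \<in> sl3" "E3 \<in> sl3" "F1 \<in> sl3" "F2 \<in> sl3" "F3 \<in> sl3" "H1 \<in> sl3" "H2 \<in> sl3"
  by (simp_all add: sl3_def trace_def root_basis_defs matrix_unit_def sum_3)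

lemma sl3_closed:
  shows "x \<in> sl3 \<Longrightarrow> y \<in> sl3 \<Longrightarrow> x + y \<in> sl3"
    and "x \<in> sl3 \<Longrightarrow> mat c ** x \<in> sl3"
    and "x \<in> sl3 \<Longrightarrow> transpose x \<in> sl3"
    and "lie_bracket x y \<in> sl3"
proof -
  show "x \<in> sl3 \<Longrightarrow> y \<in> sl3 \<Longrightarrow> x + y \<in> sl3"
    by (simp add: sl3_def trace_add)
  show "x \<in> sl3 \<Longrightarrow> transpose x \<in> sl3"
    by (simp add: sl3_def trace_def transpose_def)
  show "lie_bracket x y \<in> sl3"
    by (simp add: sl3_def lie_bracket_def trace_sub trace_mul_sym[of x y])
  have "trace (mat c ** x) = c * trace x"
    by (simp add: trace_def matrix_matrix_mult_def mat_def if_distrib [of "\<lambda>c. c * _"] sum_distrib_left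
        cong: if_cong)
  then show "x \<in> sl3 \<Longrightarrow> mat c ** x \<in> sl3"
    by (simp add: sl3_def)
qed

text \<open>
  The signs are those of matrix units, whence \<open>E3 = [E1, E2]\<close> but \<open>F3 = [F2, F1]\<close>.
\<close>

lemma root_brackets:
  "lie_bracket E1 F1 = H1" "lie_bracket E1 F2 = 0" "lie_bracket E1 F3 = mat (-1) ** F2"
  "lie_bracket E2 F1 = 0" "lie_bracket E2 F2 = H2" "lie_bracket E2 F3 = F1"
  "lie_bracket E3 F1 = mat (-1) ** E2" "lie_bracket E3 F2 = E1" "lie_bracket E3 F3 = H1 + H2"
  "lie_bracket E1 E2 = E3" "lie_bracket E1 E3 = 0" "lie_bracket E2 E3 = 0"
  "lie_bracket F2 F1 = F3" "lie_bracket F3 F1 = 0" "lie_bracket F3 F2 = 0"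
  "lie_bracket H1 H2 = 0"
  "lie_bracket H1 F1 = mat (-2) ** F1" "lie_bracket H1 F2 = F2" "lie_bracket H1 F3 = mat (-1) ** F3"
  "lie_bracket H2 F1 = F1" "lie_bracket H2 F2 = mat (-2) ** F2" "lie_bracket H2 F3 = mat (-1) ** F3"
  "lie_bracket H1 E1 = mat 2 ** E1" "lie_bracket H1 E2 = mat (-1) ** E2" "lie_bracket H1 E3 = E3"
  "lie_bracket H2 E1 = mat (-1) ** E1" "lie_bracket H2 E2 = mat 2 ** E2" "lie_bracket H2 E3 = E3"
  by (simp_all add: root_basis_defs lie_bracket_def vec_eq_iff forall_3 matrix_matrix_mult_def sum_3
      matrix_unit_def mat_def)

lemma sl3_root_expansion:
  assumes "x \<in> sl3"
  shows "x = mat (x$1$2) ** E1 + mat (x$2$3) ** E2 + mat (x$1$3) ** E3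
           + mat (x$2$1) ** F1 + mat (x$3$2) ** F2 + mat (x$3$1) ** F3
           + mat (x$1$1) ** H1 + mat (x$1$1 + x$2$2) ** H2"
  using assms by (auto simp: sl3_def trace_def root_basis_defs vec_eq_iff forall_3
      matrix_matrix_mult_def sum_3 matrix_unit_def mat_def algebra_simps add_eq_0_iff2)

lemma transpose_root_basis [simp]:
  "transpose E1 = F1" "transpose E2 = F2" "transpose E3 = F3"
  "transpose F1 = E1" "transpose F2 = E2" "transpose F3 = E3"
  "transpose H1 = H1" "transpose H2 = H2"
  by (simp_all add: root_basis_defs vec_eq_iff forall_3 matrix_unit_def transpose_def)

lemma mat_mult_vector [simp]: "mat c *v x = (c :: complex) *s x"
  by (simp add: vec_eq_iff matrix_vector_mult_def mat_def if_distrib [of "\<lambda>c. c * _"] cong: if_cong)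

lemma scalar_mult_vector: "(mat c ** A) *v x = (c :: complex) *s (A *v x)"
  by (simp flip: matrix_vector_mul_assoc)

lemma H_in_cartan: "H1 \<in> cartan" "H2 \<in> cartan"
proof -
  have "\<forall>i j. i \<noteq> j \<longrightarrow> H1 $ i $ j = 0" "\<forall>i j. i \<noteq> j \<longrightarrow> H2 $ i $ j = 0"
    by (simp_all only: forall_3) (simp_all add: root_basis_defs matrix_unit_def)
  then show "H1 \<in> cartan" "H2 \<in> cartan"
    by (auto simp: cartan_def)
qed

lemma weight_eval_H:
  "weight_eval \<Lambda> H1 = weight_form \<Lambda> alpha1" "weight_eval \<Lambda> H2 = weight_form \<Lambda> alpha2"
  by (simp_all add: weight_eval_def weight_form_def alpha1_def alpha2_def sum_3)
     (simp_all add: root_basis_defs matrix_unit_def)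

lemma weight_eval_expand:
  assumes "h \<in> sl3"
  shows "weight_eval \<Lambda> h = h$1$1 * weight_eval \<Lambda> H1 + (h$1$1 + h$2$2) * weight_eval \<Lambda> H2"
proof -
  have "\<Lambda>$3 * (h$1$1 + h$2$2 + h$3$3) = 0"
    using assms by (simp add: sl3_def trace_def sum_3)
  then show ?thesis
    unfolding weight_eval_H
    by (simp add: weight_eval_def weight_form_def alpha1_def alpha2_def sum_3 algebra_simps)
qed

section \<open>Modules, weight vectors and highest weight vectors\<close>

locale sl3_rep =
  fixes \<sigma> :: "complex^3^3 \<Rightarrow> complex^'n^'n"
  assumes module: "sl3_module \<sigma>"
begin

abbreviation e1 where "e1 x \<equiv> \<sigma> E1 *v x"
abbreviation e2 where "e2 x \<equiv> \<sigma> E2 *v x"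
abbreviation e3 where "e3 x \<equiv> \<sigma> E3 *v x"
abbreviation f1 where "f1 x \<equiv> \<sigma> F1 *v x"
abbreviation f2 where "f2 x \<equiv> \<sigma> F2 *v x"
abbreviation f3 where "f3 x \<equiv> \<sigma> F3 *v x"
abbreviation h1 where "h1 x \<equiv> \<sigma> H1 *v x"
abbreviation h2 where "h2 x \<equiv> \<sigma> H2 *v x"

lemma act_add: "x \<in> sl3 \<Longrightarrow> y \<in> sl3 \<Longrightarrow> \<sigma> (x + y) *v v = \<sigma> x *v v + \<sigma> y *v v"
  using module unfolding sl3_module_def by (metis matrix_vector_mult_add_rdistrib)

lemma act_scale: "x \<in> sl3 \<Longrightarrow> \<sigma> (mat c ** x) *v v = c *s (\<sigma> x *v v)"
  using module unfolding sl3_module_def by (metis scalar_mult_vector)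

lemma act_zero: "\<sigma> 0 *v v = 0"
proof -
  have "mat 0 ** H1 = 0"
    by (simp add: vec_eq_iff matrix_matrix_mult_def mat_def)
  then show ?thesis
    using act_scale[of H1 0 v] by simp
qed

lemma act_commute:
  assumes "x \<in> sl3" "y \<in> sl3"
  shows "\<sigma> x *v (\<sigma> y *v v) = \<sigma> y *v (\<sigma> x *v v) + \<sigma> (lie_bracket x y) *v v"
proof -
  have "\<sigma> (lie_bracket x y) = lie_bracket (\<sigma> x) (\<sigma> y)"
    using module assms by (auto simp: sl3_module_def)
  then show ?thesis
    by (simp add: lie_bracket_def matrix_vector_mult_diff_rdistrib matrix_vector_mul_assoc)
qed

lemmas act_rules = root_brackets act_add act_scale act_zero

text \<open>
  Oriented so that rewriting moves lowering operators to the front and Cartan and raising operators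
  towards the vector, which in the applications is a highest weight vector. This is the normal form
  behind the Poincare-Birkhoff-Witt theorem.
\<close>

lemma commute_rules:
  "e1 (f1 x) = f1 (e1 x) + h1 x" "e1 (f2 x) = f2 (e1 x)" "e1 (f3 x) = f3 (e1 x) - f2 x"
  "e2 (f1 x) = f1 (e2 x)" "e2 (f2 x) = f2 (e2 x) + h2 x" "e2 (f3 x) = f3 (e2 x) + f1 x"
  "e3 (f1 x) = f1 (e3 x) - e2 x" "e3 (f2 x) = f2 (e3 x) + e1 x"
  "e3 (f3 x) = f3 (e3 x) + h1 x + h2 x"
  "h1 (f1 x) = f1 (h1 x) - 2 *s f1 x" "h1 (f2 x) = f2 (h1 x) + f2 x" "h1 (f3 x) = f3 (h1 x) - f3 x"
  "h2 (f1 x) = f1 (h2 x) + f1 x" "h2 (f2 x) = f2 (h2 x) - 2 *s f2 x" "h2 (f3 x) = f3 (h2 x) - f3 x"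
  "f2 (f1 x) = f1 (f2 x) + f3 x" "f3 (f1 x) = f1 (f3 x)" "f3 (f2 x) = f2 (f3 x)"
  by (subst act_commute; simp add: act_rules vec.scale_minus_left)+

lemma commute_rules_h_e:
  "h1 (e1 x) = e1 (h1 x) + 2 *s e1 x" "h1 (e2 x) = e2 (h1 x) - e2 x"
  "h2 (e1 x) = e1 (h2 x) - e1 x" "h2 (e2 x) = e2 (h2 x) + 2 *s e2 x"
  by (subst act_commute; simp add: act_rules vec.scale_minus_left)+

lemma h2_h1: "h2 (h1 x) = h1 (h2 x)"
  using act_commute[of H1 H2 x] by (simp add: act_rules)

lemma e3_eq: "e3 x = e1 (e2 x) - e2 (e1 x)"
  using act_commute[of E1 E2 x] by (simp add: act_rules)

lemma f3_eq: "f3 x = f2 (f1 x) - f1 (f2 x)"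
  using act_commute[of F2 F1 x] by (simp add: act_rules)

lemma h1_eq: "h1 x = e1 (f1 x) - f1 (e1 x)"
  using act_commute[of E1 F1 x] by (simp add: act_rules)

lemma h2_eq: "h2 x = e2 (f2 x) - f2 (e2 x)"
  using act_commute[of E2 F2 x] by (simp add: act_rules)

lemma act_expand:
  assumes "x \<in> sl3"
  shows "\<sigma> x *v v = x$1$2 *s e1 v + x$2$3 *s e2 v + x$1$3 *s e3 v
           + x$2$1 *s f1 v + x$3$2 *s f2 v + x$3$1 *s f3 v
           + x$1$1 *s h1 v + (x$1$1 + x$2$2) *s h2 v"
  by (subst sl3_root_expansion[OF assms]) (simp add: act_rules sl3_closed)

text \<open>
  The simple root vectors generate the Lie algebra, so closure under four operators suffices.
\<close>

lemma submodule_generatorsI: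
  assumes S: "vec.subspace S"
    and "\<And>x. x \<in> S \<Longrightarrow> e1 x \<in> S" "\<And>x. x \<in> S \<Longrightarrow> e2 x \<in> S"
        "\<And>x. x \<in> S \<Longrightarrow> f1 x \<in> S" "\<And>x. x \<in> S \<Longrightarrow> f2 x \<in> S"
  shows "submodule \<sigma> S"
  unfolding submodule_def
proof (intro conjI ballI S)
  fix x w assume "x \<in> sl3" "w \<in> S"
  then show "\<sigma> x *v w \<in> S"
    unfolding act_expand[OF \<open>x \<in> sl3\<close>] e3_eq f3_eq h1_eq h2_eq using assms
    by (intro vec.subspace_add vec.subspace_scale vec.subspace_diff) auto
qed

lemma submoduleD:
  assumes "submodule \<sigma> S"
  shows "vec.subspace S" "x \<in> S \<Longrightarrow> e1 x \<in> S" "x \<in> S \<Longrightarrow> e2 x \<in> S" "x \<in> S \<Longrightarrow> f1 x \<in> S"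
    "x \<in> S \<Longrightarrow> f2 x \<in> S" "x \<in> S \<Longrightarrow> h1 x \<in> S" "x \<in> S \<Longrightarrow> h2 x \<in> S"
  using assms by (auto simp: submodule_def)

text \<open>
  A weight is recorded by its values on the two simple coroots, that is, by its coordinates with
  respect to the fundamental weights. The zero vector is a weight vector of every weight, so that
  weight spaces are subspaces; a highest weight vector is non-zero. It is also killed by \<open>e3\<close>, the
  commutator of \<open>e1\<close> and \<open>e2\<close>.
\<close>

definition wv :: "complex \<times> complex \<Rightarrow> complex^'n \<Rightarrow> bool" where
  "wv \<mu> x \<longleftrightarrow> h1 x = fst \<mu> *s x \<and> h2 x = snd \<mu> *s x"

definition hwv :: "complex \<times> complex \<Rightarrow> complex^'n \<Rightarrow> bool" where
  "hwv \<mu> x \<longleftrightarrow> x \<noteq> 0 \<and> wv \<mu> x \<and> e1 x = 0 \<and> e2 x = 0"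

lemma subspace_wv: "vec.subspace {x. wv \<mu> x}"
  by (auto simp: vec.subspace_def wv_def vec.add vec.scale vec.scale_right_distrib mult.commute)

lemma wv_root:
  assumes "wv (a, b) x"
  shows "wv (a + 2, b - 1) (e1 x)" "wv (a - 1, b + 2) (e2 x)"
    "wv (a - 2, b + 1) (f1 x)" "wv (a + 1, b - 2) (f2 x)"
  using assms
  by (simp_all add: wv_def commute_rules commute_rules_h_e vec.scale)

lemma highest_weight_vector_iff:
  "highest_weight_vector \<sigma> \<Lambda> v \<longleftrightarrow> hwv (weight_form \<Lambda> alpha1, weight_form \<Lambda> alpha2) v"
proof -
  note H = H_in_cartan and E = weight_eval_H
  have "\<sigma> h *v v = weight_eval \<Lambda> h *s v"
    if "hwv (weight_form \<Lambda> alpha1, weight_form \<Lambda> alpha2) v" "h \<in> cartan" for h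
  proof -
    have h: "h \<in> sl3" and off: "h$1$2 = 0" "h$2$3 = 0" "h$1$3 = 0" "h$2$1 = 0" "h$3$2 = 0" "h$3$1 = 0"
      using that(2) by (simp_all add: cartan_def)
    have "\<sigma> h *v v = h$1$1 *s h1 v + (h$1$1 + h$2$2) *s h2 v"
      by (simp add: act_expand[OF h] off)
    also have "\<dots> = weight_eval \<Lambda> h *s v"
      using that(1) by (simp add: hwv_def wv_def weight_eval_expand[OF h] E vec.scale_left_distrib)
    finally show ?thesis .
  qed
  moreover have "e3 v = 0" if "hwv (weight_form \<Lambda> alpha1, weight_form \<Lambda> alpha2) v"
    using that by (simp add: hwv_def e3_eq)
  moreover have "h1 v = weight_form \<Lambda> alpha1 *s v" "h2 v = weight_form \<Lambda> alpha2 *s v"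
    if "\<forall>h\<in>cartan. \<sigma> h *v v = weight_eval \<Lambda> h *s v"
    using that H E by metis+
  ultimately show ?thesis
    unfolding highest_weight_vector_def E1_def[symmetric] E2_def[symmetric] E3_def[symmetric]
      ball_simps hwv_def wv_def fst_conv snd_conv
    by blast
qed

end

section \<open>Weight decompositions and dominance\<close>

text \<open>
  The components of an element of an invariant subspace with respect to a family of joint eigenspaces
  lie in the subspace. Two different eigencharacters \<open>\<omega> \<mu>\<close> and \<open>\<omega> \<nu>\<close> differ at some operator \<open>T i\<close>;
  applying \<open>T i\<close> minus its eigenvalue at \<open>\<nu>\<close> removes the component at \<open>\<nu>\<close> and rescales the one at \<open>\<mu>\<close> by
  a non-zero factor. With \<open>S = {0}\<close> this is the independence of eigenvectors.
\<close>

lemma eigen_components_mem: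
  fixes g :: "'w \<Rightarrow> complex^'n" and T :: "'i \<Rightarrow> complex^'n^'n"
  assumes S: "vec.subspace S" and inv: "\<And>i x. x \<in> S \<Longrightarrow> T i *v x \<in> S"
    and "finite F"
    and "\<And>\<mu> i. \<mu> \<in> F \<Longrightarrow> T i *v g \<mu> = \<omega> \<mu> i *s g \<mu>"
    and "\<And>\<mu> \<nu>. \<mu> \<in> F \<Longrightarrow> \<nu> \<in> F \<Longrightarrow> \<mu> \<noteq> \<nu> \<Longrightarrow> \<exists>i. \<omega> \<mu> i \<noteq> \<omega> \<nu> i"
    and "(\<Sum>\<mu>\<in>F. g \<mu>) \<in> S"
  shows "\<forall>\<mu>\<in>F. g \<mu> \<in> S"
  using assms(3-6)
proof (induction F arbitrary: g)
  case (insert \<nu> F)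
  let ?y = "\<Sum>\<mu>\<in>insert \<nu> F. g \<mu>"
  have mem: "g \<mu> \<in> S" if \<mu>: "\<mu> \<in> F" for \<mu>
  proof -
    obtain i where i: "\<omega> \<mu> i \<noteq> \<omega> \<nu> i"
      using insert.prems(2)[of \<mu> \<nu>] \<mu> insert.hyps(2) by auto
    let ?g = "\<lambda>\<kappa>. (\<omega> \<kappa> i - \<omega> \<nu> i) *s g \<kappa>"
    have eig: "T i *v g \<kappa> = \<omega> \<kappa> i *s g \<kappa>" if "\<kappa> \<in> insert \<nu> F" for \<kappa>
      using insert.prems(1) that by blast
    have "T i *v ?y = (\<Sum>\<kappa>\<in>insert \<nu> F. \<omega> \<kappa> i *s g \<kappa>)"
      by (subst vec.sum, rule sum.cong[OF refl], rule eig)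
    then have "T i *v ?y - \<omega> \<nu> i *s ?y = (\<Sum>\<kappa>\<in>insert \<nu> F. ?g \<kappa>)"
      by (simp add: vec.scale_sum_right sum_subtractf del: sum.insert)
    also have "\<dots> = (\<Sum>\<kappa>\<in>F. ?g \<kappa>)"
      using insert.hyps by simp
    finally have "(\<Sum>\<kappa>\<in>F. ?g \<kappa>) \<in> S"
      using vec.subspace_diff[OF S inv[OF insert.prems(3)] vec.subspace_scale[OF S insert.prems(3)]]
      by metis
    moreover have "T j *v ?g \<kappa> = \<omega> \<kappa> j *s ?g \<kappa>" if "\<kappa> \<in> F" for \<kappa> j
      using insert.prems(1) that by (simp add: vec.scale vec.diff mult.commute)
    ultimately have "?g \<mu> \<in> S"
      using insert.IH[of ?g] insert.prems(2) \<mu> by blast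
    then have "inverse (\<omega> \<mu> i - \<omega> \<nu> i) *s ?g \<mu> \<in> S"
      by (rule vec.subspace_scale[OF S])
    moreover have "\<omega> \<mu> i - \<omega> \<nu> i \<noteq> 0"
      using i by simp
    ultimately show ?thesis
      by (simp only: vec.scale_scale left_inverse vec.scale_one not_False_eq_True)
  qed
  have "?y - (\<Sum>\<mu>\<in>F. g \<mu>) \<in> S"
    by (rule vec.subspace_diff[OF S insert.prems(3) vec.subspace_sum[OF S mem]])
  then show ?case
    using mem insert.hyps by simp
qed simp

lemma finite_eigenvalues:
  fixes A :: "complex^'n^'n"
  shows "finite {c. \<exists>x. x \<noteq> 0 \<and> A *v x = c *s x}"
proof -
  define E where "E = {c. \<exists>x. x \<noteq> 0 \<and> A *v x = c *s x}"
  define g where "g c = (SOME x. x \<noteq> 0 \<and> A *v x = c *s x)" for c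
  have g: "g c \<noteq> 0 \<and> A *v g c = c *s g c" if "c \<in> E" for c
    unfolding g_def by (rule someI_ex) (use that E_def in simp)
  have inj: "inj_on g E"
  proof (rule inj_onI)
    fix c d assume c: "c \<in> E" and d: "d \<in> E" and eq: "g c = g d"
    have "c *s g c = d *s g c"
      using conjunct2[OF g[OF c]] conjunct2[OF g[OF d]] unfolding eq by metis
    then show "c = d"
      using conjunct1[OF g[OF c]] by simp
  qed
  have "vec.independent (g ` E)"
    unfolding vec.independent_explicit_module
  proof (intro allI impI)
    fix U u v
    assume U: "finite U" "U \<subseteq> g ` E" "(\<Sum>v\<in>U. u v *s v) = 0" and v: "v \<in> U"
    define D where "D = {c \<in> E. g c \<in> U}"
    have D: "U = g ` D" "D \<subseteq> E"
      using U(2) by (auto simp: D_def)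
    then have "inj_on g D"
      using inj inj_on_subset by blast
    then have "finite D"
      using U(1) D(1) finite_image_iff by blast
    have "(\<Sum>c\<in>D. u (g c) *s g c) \<in> {0}"
      using U(3) D(1) \<open>inj_on g D\<close> by (simp add: sum.reindex)
    moreover have "A *v (u (g c) *s g c) = c *s (u (g c) *s g c)" if "c \<in> D" for c
      using g D(2) that by (auto simp: vec.scale mult.commute)
    ultimately have "\<forall>c\<in>D. u (g c) *s g c \<in> {0}"
      using \<open>finite D\<close>
      by (intro eigen_components_mem[where T = "\<lambda>_::unit. A" and \<omega> = "\<lambda>c _. c"]) auto
    moreover obtain c where "c \<in> D" "v = g c"
      using v D by auto
    ultimately show "u v = 0"
      using g D(2) by (auto simp: vector_mul_eq_0)
  qed
  then have "finite (g ` E)"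
    by (rule vec.finiteI_independent)
  then show ?thesis
    using inj unfolding E_def by (rule finite_imageD)
qed

lemma span_invariant:
  fixes A :: "complex^'n^'n"
  assumes "\<And>b. b \<in> B \<Longrightarrow> A *v b \<in> vec.span C" "x \<in> vec.span B"
  shows "A *v x \<in> vec.span C"
  using assms(2)
proof (induction rule: vec.span_induct_alt)
  case base
  then show ?case by (simp add: vec.span_zero)
next
  case (step c x y)
  then show ?case
    using assms(1) by (simp add: vec.add vec.scale vec.span_add vec.span_scale)
qed

text \<open>
  The string \<open>r, F r, F F r, ...\<close> consists of eigenvectors of \<open>H\<close> with pairwise different eigenvalues
  \<open>a - 2 k\<close>, so it breaks off in finite dimension. If \<open>s (Suc k)\<close> is its first vanishing member, then
  \<open>E\<close> maps \<open>s (Suc k) = 0\<close> to \<open>(k + 1) (a - k)\<close> times \<open>s k \<noteq> 0\<close>, and \<open>a = k\<close> follows.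
\<close>

lemma sl2_highest_weight_nat:
  fixes E F H :: "complex^'n^'n"
  assumes EF: "\<And>x. E *v (F *v x) = F *v (E *v x) + H *v x"
    and HF: "\<And>x. H *v (F *v x) = F *v (H *v x) - 2 *s (F *v x)"
    and r: "H *v r = a *s r" "E *v r = 0" "r \<noteq> 0"
  shows "a \<in> \<nat>"
proof -
  define s where "s k = (((*v) F) ^^ k) r" for k
  have s_Suc: "s (Suc k) = F *v s k" for k
    by (simp add: s_def)
  have H: "H *v s k = (a - 2 * of_nat k) *s s k" for k
  proof (induction k)
    case 0
    then show ?case using r by (simp add: s_def)
  next
    case (Suc k)
    then show ?case
      by (simp add: s_Suc HF vec.scale vec.diff)
  qed
  have E: "E *v s (Suc k) = (of_nat (Suc k) * (a - of_nat k)) *s s k" for k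
  proof (induction k)
    case 0
    then show ?case using r by (simp add: s_def EF)
  next
    case (Suc k)
    then show ?case
      unfolding s_Suc[of "Suc k"] EF H
      by (simp add: s_Suc vec.scale) (simp add: vec_eq_iff algebra_simps)
  qed
  have "\<exists>k. s k = 0"
  proof (rule ccontr)
    assume "\<nexists>k. s k = 0"
    then have "range (\<lambda>k. a - 2 * of_nat k) \<subseteq> {c. \<exists>x. x \<noteq> 0 \<and> H *v x = c *s x}"
      using H by blast
    then have "finite (range (\<lambda>k. a - 2 * of_nat k :: complex))"
      using finite_eigenvalues finite_subset by blast
    moreover have "inj (\<lambda>k. a - 2 * of_nat k :: complex)"
      by (rule injI) simp
    ultimately show False
      using finite_imageD infinite_UNIV_nat by blast
  qed
  then have "s (LEAST k. s k = 0) = 0"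
    by (rule LeastI_ex)
  moreover have "s 0 \<noteq> 0"
    using r by (simp add: s_def)
  ultimately obtain k where k: "(LEAST k. s k = 0) = Suc k" "s (Suc k) = 0"
    by (metis not0_implies_Suc)
  then have "s k \<noteq> 0"
    using not_less_Least[of k "\<lambda>k. s k = 0"] by simp
  then have "a = of_nat k"
    using E[of k] k(2) by (simp add: vector_mul_eq_0) (metis of_nat_Suc of_nat_neq_0)
  then show ?thesis
    by simp
qed

text \<open>
  With \<open>\<Lambda> = (p, q)\<close> and \<open>\<mu> = (p', q') = \<Lambda> - m \<alpha>1 - n \<alpha>2\<close>, the difference of the Casimir values is a
  multiple of the scalar product of \<open>\<Lambda> - \<mu>\<close> with \<open>\<Lambda> + \<mu> + 2 \<rho>\<close>. The second weight is strictly dominant, so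
  the product is positive unless \<open>\<Lambda> = \<mu>\<close>.
\<close>

lemma casimir_value_separates:
  fixes p q m n p' q' :: int
  assumes "p \<ge> 0" "q \<ge> 0" "p' \<ge> 0" "q' \<ge> 0" "m \<ge> 0" "n \<ge> 0"
    and eq: "p' = p - 2 * m + n" "q' = q + m - 2 * n"
    and "p\<^sup>2 + p * q + q\<^sup>2 + 3 * (p + q) = p'\<^sup>2 + p' * q' + q'\<^sup>2 + 3 * (p' + q')"
  shows "m = 0 \<and> n = 0"
proof -
  have "3 * (m * (p + p' + 2) + n * (q + q' + 2)) =
      2 * (p\<^sup>2 + p * q + q\<^sup>2 + 3 * (p + q)) - 2 * (p'\<^sup>2 + p' * q' + q'\<^sup>2 + 3 * (p' + q'))"
    unfolding eq by (simp add: power2_eq_square algebra_simps)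
  then have "m * (p + p' + 2) + n * (q + q' + 2) = 0"
    using assms(9) by simp
  moreover have "m * (p + p' + 2) \<ge> 0" "n * (q + q' + 2) \<ge> 0"
    using assms by simp_all
  ultimately have "m * (p + p' + 2) = 0" "n * (q + q' + 2) = 0"
    by linarith+
  then show ?thesis
    using assms by auto
qed

context sl3_rep
begin

lemma weight_components_mem:
  assumes "vec.subspace S" "\<And>x. x \<in> S \<Longrightarrow> h1 x \<in> S" "\<And>x. x \<in> S \<Longrightarrow> h2 x \<in> S"
    and "finite F" "\<And>\<mu>. \<mu> \<in> F \<Longrightarrow> wv \<mu> (g \<mu>)" "(\<Sum>\<mu>\<in>F. g \<mu>) \<in> S" "\<mu> \<in> F"
  shows "g \<mu> \<in> S"
proof -
  have "\<forall>\<mu>\<in>F. g \<mu> \<in> S"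
    using assms
    by (intro eigen_components_mem[where T = "\<lambda>i. if i then \<sigma> H1 else \<sigma> H2"
          and \<omega> = "\<lambda>\<mu> i. if i then fst \<mu> else snd \<mu>"])
       (auto simp: wv_def prod_eq_iff split: if_splits)
  then show ?thesis using assms by blast
qed

lemma wv_unique:
  assumes "wv \<mu> x" "wv \<nu> x" "x \<noteq> 0"
  shows "\<mu> = \<nu>"
proof -
  have "fst \<mu> *s x = fst \<nu> *s x" "snd \<mu> *s x = snd \<nu> *s x"
    using assms(1,2) unfolding wv_def by metis+
  then show ?thesis
    using assms(3) by (simp add: prod_eq_iff)
qed

lemma span_wv: "x \<in> vec.span {b \<in> B. wv \<mu> b} \<Longrightarrow> wv \<mu> x"
  using vec.span_minimal[OF _ subspace_wv[of \<mu>], of "{b \<in> B. wv \<mu> b}"] by auto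

lemma weight_decomposition:
  assumes "y \<in> vec.span B" "\<And>b. b \<in> B \<Longrightarrow> \<exists>\<mu>. wv \<mu> b"
  obtains F g where "finite F" "\<And>\<mu>. \<mu> \<in> F \<Longrightarrow> g \<mu> \<in> vec.span {b \<in> B. wv \<mu> b}" "y = (\<Sum>\<mu>\<in>F. g \<mu>)"
proof -
  have "\<exists>F g. finite F \<and> (\<forall>\<mu>\<in>F. g \<mu> \<in> vec.span {b \<in> B. wv \<mu> b}) \<and> y = (\<Sum>\<mu>\<in>F. g \<mu>)"
    using assms(1)
  proof (induction rule: vec.span_induct_alt)
    case base
    then show ?case by (intro exI[of _ "{}"]) auto
  next
    case (step c b y)
    obtain \<nu> where \<nu>: "wv \<nu> b"
      using assms(2) step.hyps by blast
    obtain F g where F: "finite F" "\<And>\<mu>. \<mu> \<in> F \<Longrightarrow> g \<mu> \<in> vec.span {b \<in> B. wv \<mu> b}" "y = (\<Sum>\<mu>\<in>F. g \<mu>)"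
      using step.IH by blast
    let ?k = "\<lambda>\<mu>. (if \<mu> = \<nu> then c *s b else 0) + (if \<mu> \<in> F then g \<mu> else 0)"
    have "(\<Sum>\<mu>\<in>insert \<nu> F. ?k \<mu>) = c *s b + (\<Sum>\<mu>\<in>insert \<nu> F. if \<mu> \<in> F then g \<mu> else 0)"
      using F(1) by (simp add: sum.distrib sum.delta del: sum.insert)
    also have "(\<Sum>\<mu>\<in>insert \<nu> F. if \<mu> \<in> F then g \<mu> else 0) = y"
      using F(1,3) by (simp add: sum.inter_restrict[symmetric] Int_absorb1 subset_insertI del: sum.insert)
    finally have "c *s b + y = (\<Sum>\<mu>\<in>insert \<nu> F. ?k \<mu>)" ..
    moreover have "?k \<mu> \<in> vec.span {b \<in> B. wv \<mu> b}" for \<mu>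
      using \<nu> step.hyps F(2) by (intro vec.span_add) (auto intro: vec.span_scale vec.span_base vec.span_zero)
    ultimately show ?case
      using F(1) by (intro exI[of _ "insert \<nu> F"] exI[of _ ?k]) auto
  qed
  then show ?thesis using that by blast
qed

lemma weight_vector_in_span:
  assumes "y \<in> vec.span B" "\<And>b. b \<in> B \<Longrightarrow> \<exists>\<mu>. wv \<mu> b" "wv \<mu> y"
  shows "y \<in> vec.span {b \<in> B. wv \<mu> b}"
proof -
  obtain F g where F: "finite F" "\<And>\<mu>. \<mu> \<in> F \<Longrightarrow> g \<mu> \<in> vec.span {b \<in> B. wv \<mu> b}" "y = (\<Sum>\<mu>\<in>F. g \<mu>)"
    using weight_decomposition[OF assms(1,2)] by blast
  let ?k = "\<lambda>\<nu>. (if \<nu> \<in> F then g \<nu> else 0) - (if \<nu> = \<mu> then y else 0)"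
  have "(\<Sum>\<nu>\<in>insert \<mu> F. if \<nu> \<in> F then g \<nu> else 0) = y"
    using F(1,3) by (simp add: sum.inter_restrict[symmetric] Int_absorb1 subset_insertI del: sum.insert)
  then have "(\<Sum>\<nu>\<in>insert \<mu> F. ?k \<nu>) \<in> {0}"
    using F(1) by (simp add: sum_subtractf sum.delta del: sum.insert)
  moreover have "wv \<nu> (?k \<nu>)" for \<nu>
    using assms(3) span_wv[OF F(2)] vec.subspace_diff[OF subspace_wv] vec.subspace_0[OF subspace_wv]
    by (auto simp: vec.subspace_def)
  ultimately have "?k \<mu> \<in> {0}"
    using F(1) by (intro weight_components_mem[where F = "insert \<mu> F" and g = ?k]) auto
  then show ?thesis
    using F(2)[of \<mu>] by (auto simp: vec.span_zero split: if_splits)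
qed

text \<open>
  Spanned by weight vectors. In the modules below this comes from generation by highest weight vectors,
  and it passes to submodules and tensor products.
\<close>

definition weighted :: "(complex^'n) set \<Rightarrow> bool" where
  "weighted S \<longleftrightarrow> S \<subseteq> vec.span {x \<in> S. \<exists>\<mu>. wv \<mu> x}"

lemma weighted_subspace:
  assumes T: "weighted T" and S: "vec.subspace S" "S \<subseteq> T" "\<And>x. x \<in> S \<Longrightarrow> h1 x \<in> S" "\<And>x. x \<in> S \<Longrightarrow> h2 x \<in> S"
  shows "weighted S"
  unfolding weighted_def
proof
  fix x assume x: "x \<in> S"
  then have "x \<in> vec.span {x \<in> T. \<exists>\<mu>. wv \<mu> x}"
    using T S(2) by (auto simp: weighted_def)
  then obtain F g where F: "finite F" "x = (\<Sum>\<mu>\<in>F. g \<mu>)"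
    and g: "\<And>\<mu>. \<mu> \<in> F \<Longrightarrow> g \<mu> \<in> vec.span {b \<in> {x \<in> T. \<exists>\<mu>. wv \<mu> x}. wv \<mu> b}"
    by (rule weight_decomposition) auto
  have wv: "wv \<mu> (g \<mu>)" if "\<mu> \<in> F" for \<mu>
    using span_wv[OF g[OF that]] .
  then have "g \<mu> \<in> S" if "\<mu> \<in> F" for \<mu>
    using weight_components_mem[OF S(1,3,4) F(1)] F(2) x that by blast
  with wv show "x \<in> vec.span {x \<in> S. \<exists>\<mu>. wv \<mu> x}"
    unfolding F(2) by (intro vec.span_sum vec.span_base) auto
qed

text \<open>
  Weights are compared by the real part of their value on \<open>H1 + H2\<close>, which is raised by one by each of
  the simple root vectors. Finitely many eigenvalues occur, so a maximum exists, and a weight vector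
  at which it is attained is killed by \<open>e1\<close> and \<open>e2\<close>.
\<close>

lemma exists_top_weight:
  assumes "weighted S" "x \<in> S" "x \<noteq> 0"
  obtains \<mu> v where "v \<in> S" "v \<noteq> 0" "wv \<mu> v"
    "\<And>\<nu> y. y \<in> S \<Longrightarrow> wv \<nu> y \<Longrightarrow> Re (fst \<mu> + snd \<mu>) < Re (fst \<nu> + snd \<nu>) \<Longrightarrow> y = 0"
proof -
  define C where "C = {c. \<exists>x\<in>S. x \<noteq> 0 \<and> (\<exists>\<mu>. wv \<mu> x \<and> c = fst \<mu> + snd \<mu>)}"
  have "C \<subseteq> {c. \<exists>x. x \<noteq> 0 \<and> (\<sigma> H1 + \<sigma> H2) *v x = c *s x}"
    by (auto simp: C_def wv_def matrix_vector_mult_add_rdistrib vec.scale_left_distrib)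
  then have fin: "finite (Re ` C)"
    using finite_eigenvalues finite_subset by blast
  have "\<exists>x\<in>S. x \<noteq> 0 \<and> (\<exists>\<mu>. wv \<mu> x)"
  proof (rule ccontr)
    assume "\<not> ?thesis"
    then have "{x \<in> S. \<exists>\<mu>. wv \<mu> x} \<subseteq> {0}"
      by blast
    then have "vec.span {x \<in> S. \<exists>\<mu>. wv \<mu> x} \<subseteq> {0}"
      by (metis vec.span_empty vec.span_insert_0 vec.span_mono)
    with assms show False
      by (auto simp: weighted_def)
  qed
  then have "Re ` C \<noteq> {}"
    by (auto simp: C_def)
  then have "Max (Re ` C) \<in> Re ` C"
    using fin by simp
  then obtain v \<mu> where v: "v \<in> S" "v \<noteq> 0" "wv \<mu> v" "Max (Re ` C) = Re (fst \<mu> + snd \<mu>)"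
    by (auto simp: C_def)
  have "y = 0" if "y \<in> S" "wv \<nu> y" "Re (fst \<mu> + snd \<mu>) < Re (fst \<nu> + snd \<nu>)" for \<nu> y
  proof (rule ccontr)
    assume "y \<noteq> 0"
    then have "fst \<nu> + snd \<nu> \<in> C"
      unfolding C_def using that by blast
    then have "Re (fst \<nu> + snd \<nu>) \<in> Re ` C"
      by (rule imageI)
    then show False
      using Max_ge[OF fin] v(4) that(3) by fastforce
  qed
  then show ?thesis
    using that v by blast
qed

lemma top_weight_imp_hwv:
  assumes "v \<in> S" "v \<noteq> 0" "wv \<mu> v" and E: "e1 v \<in> S" "e2 v \<in> S"
    and top: "\<And>\<nu> y. y \<in> S \<Longrightarrow> wv \<nu> y \<Longrightarrow> Re (fst \<mu> + snd \<mu>) < Re (fst \<nu> + snd \<nu>) \<Longrightarrow> y = 0"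
  shows "hwv \<mu> v"
proof -
  obtain a b where \<mu>: "\<mu> = (a, b)" by (cases \<mu>)
  show ?thesis
    using assms top[OF E(1) wv_root(1)[of a b v]] top[OF E(2) wv_root(2)[of a b v]]
    by (simp add: hwv_def \<mu>)
qed

lemma hwv_dominant:
  assumes "hwv (a, b) v"
  shows "a \<in> \<nat>" "b \<in> \<nat>"
  using assms sl2_highest_weight_nat[of "\<sigma> E1" "\<sigma> F1" "\<sigma> H1" v a]
    sl2_highest_weight_nat[of "\<sigma> E2" "\<sigma> F2" "\<sigma> H2" v b]
  by (simp_all add: hwv_def wv_def commute_rules)

section \<open>Submodules generated by a highest weight vector\<close>

text \<open>
  Words in the lowering operators applied to \<open>v\<close>, indexed by the numbers of letters \<open>f1\<close> and \<open>f2\<close>, hence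
  by the weight relative to that of \<open>v\<close>. For a highest weight vector \<open>v\<close> their span \<open>gen v\<close> is the
  submodule that \<open>v\<close> generates.
\<close>

inductive fword :: "complex^'n \<Rightarrow> nat \<Rightarrow> nat \<Rightarrow> complex^'n \<Rightarrow> bool" for v where
  fword_0: "fword v 0 0 v"
| fword_f1: "fword v m n x \<Longrightarrow> fword v (Suc m) n (f1 x)"
| fword_f2: "fword v m n x \<Longrightarrow> fword v m (Suc n) (f2 x)"

abbreviation fwords where "fwords v \<equiv> {x. \<exists>m n. fword v m n x}"

definition gen :: "complex^'n \<Rightarrow> (complex^'n) set" where
  "gen v = vec.span (fwords v)"

lemma fword_wv:
  assumes "fword v m n x" "wv (a, b) v"
  shows "wv (a - 2 * of_nat m + of_nat n, b + of_nat m - 2 * of_nat n) x"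
  using assms
proof induction
  case (fword_f1 m n x)
  then show ?case using wv_root(3) by (fastforce simp: algebra_simps)
next
  case (fword_f2 m n x)
  then show ?case using wv_root(4) by (fastforce simp: algebra_simps)
qed simp

lemma fwords_wv: "wv \<mu> v \<Longrightarrow> x \<in> fwords v \<Longrightarrow> \<exists>\<nu>. wv \<nu> x"
  using fword_wv[of v _ _ x "fst \<mu>" "snd \<mu>"] by fastforce

lemma gen_base: "v \<in> gen v"
  unfolding gen_def by (rule vec.span_base) (blast intro: fword_0)

lemma gen_f: "x \<in> gen v \<Longrightarrow> f1 x \<in> gen v" "x \<in> gen v \<Longrightarrow> f2 x \<in> gen v"
  unfolding gen_def by (rule span_invariant; force intro: vec.span_base fword_f1 fword_f2)+

lemma submodule_gen:
  assumes v: "hwv \<mu> v"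
  shows "submodule \<sigma> (gen v)"
proof (rule submodule_generatorsI)
  show sub: "vec.subspace (gen v)"
    by (simp add: gen_def)
  have h: "h1 x \<in> gen v \<and> h2 x \<in> gen v" if fw: "fword v m n x" for m n x
  proof -
    have "x \<in> gen v"
      using fw by (auto simp: gen_def intro: vec.span_base)
    moreover obtain \<nu> where "wv \<nu> x"
      using fwords_wv v fw unfolding hwv_def by blast
    ultimately show ?thesis
      by (simp only: wv_def vec.subspace_scale[OF sub])
  qed
  have e: "e1 x \<in> gen v \<and> e2 x \<in> gen v" if "fword v m n x" for m n x
    using that
  proof induction
    case fword_0
    then show ?case using v vec.subspace_0[OF sub] by (simp add: hwv_def)
  next
    case (fword_f1 m n x)
    then show ?case using h by (auto simp: commute_rules gen_f intro: vec.subspace_add[OF sub])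
  next
    case (fword_f2 m n x)
    then show ?case using h by (auto simp: commute_rules gen_f intro: vec.subspace_add[OF sub])
  qed
  show "x \<in> gen v \<Longrightarrow> e1 x \<in> gen v" "x \<in> gen v \<Longrightarrow> e2 x \<in> gen v" for x
    using e span_invariant[of "fwords v" _ "fwords v" x, folded gen_def] by blast+
qed (fact gen_f)+

lemma gen_minimal:
  assumes S: "submodule \<sigma> S" and "v \<in> S"
  shows "gen v \<subseteq> S"
proof -
  have "x \<in> S" if "fword v m n x" for m n x
    using that by induction (auto simp: assms submoduleD[OF S])
  then show ?thesis
    unfolding gen_def by (intro vec.span_minimal submoduleD[OF S]) auto
qed

text \<open>
  Three halves of the quadratic Casimir element, with all raising operators moved to the right. On a
  highest weight vector of weight \<open>(a, b)\<close> it acts by three halves of \<open>(\<Lambda>, \<Lambda> + 2 \<rho>)\<close>, which is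
  \<open>a\<^sup>2 + a b + b\<^sup>2 + 3 (a + b)\<close>.
\<close>

definition casimir :: "complex^'n \<Rightarrow> complex^'n" where
  "casimir x = h1 (h1 x) + h1 (h2 x) + h2 (h2 x) + 3 *s (h1 x + h2 x)
     + 3 *s (f1 (e1 x) + f2 (e2 x) + f3 (e3 x))"

lemma casimir_f: "casimir (f1 x) = f1 (casimir x)" "casimir (f2 x) = f2 (casimir x)"
  by (simp_all add: casimir_def commute_rules h2_h1 vec.add vec.scale vec.diff)
     (simp_all add: vec_eq_iff algebra_simps)

lemma casimir_hwv:
  assumes "hwv (a, b) v"
  shows "casimir v = (a\<^sup>2 + a * b + b\<^sup>2 + 3 * (a + b)) *s v"
  using assms
  by (simp add: casimir_def hwv_def wv_def e3_eq vec.scale)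
     (simp add: vec_eq_iff algebra_simps power2_eq_square)

lemma casimir_gen:
  assumes v: "hwv (a, b) v" and "x \<in> gen v"
  shows "casimir x = (a\<^sup>2 + a * b + b\<^sup>2 + 3 * (a + b)) *s x"
proof -
  define k where "k = a\<^sup>2 + a * b + b\<^sup>2 + 3 * (a + b)"
  have "casimir x = k *s x"
    using assms(2) unfolding gen_def
  proof (induction rule: vec.span_induct_alt)
    case base
    then show ?case by (simp add: casimir_def)
  next
    case (step c x y)
    then obtain m n where "fword v m n x"
      by blast
    then have "casimir x = k *s x"
      by induction (simp_all only: casimir_hwv[OF v] casimir_f vec.scale k_def)
    moreover have "casimir (c *s x + y) = c *s casimir x + casimir y"
      by (simp add: casimir_def vec.add vec.scale) (simp add: vec_eq_iff algebra_simps)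
    ultimately show ?case
      using step.IH by (simp add: vec_eq_iff algebra_simps)
  qed
  then show ?thesis
    by (simp only: k_def)
qed

lemma gen_top_weight_space:
  assumes "wv (a, b) v" "x \<in> gen v" "wv (a, b) x"
  shows "x \<in> vec.span {v}"
proof -
  have "{y \<in> fwords v. wv (a, b) y} \<subseteq> {0, v}"
  proof
    fix y assume "y \<in> {y \<in> fwords v. wv (a, b) y}"
    then obtain m n where y: "fword v m n y" "wv (a, b) y"
      by blast
    show "y \<in> {0, v}"
    proof (cases "y = 0")
      case False
      then have "(a - 2 * of_nat m + of_nat n, b + of_nat m - 2 * of_nat n) = (a, b)"
        using wv_unique[OF fword_wv[OF y(1) assms(1)] y(2)] by blast
      then have eqs: "a - 2 * of_nat m + of_nat n = a" "b + of_nat m - 2 * of_nat n = b"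
        by blast+
      have "of_nat n = (of_nat (2 * m) :: complex)"
        using eqs(1) by (simp add: algebra_simps del: of_nat_eq_iff)
      moreover have "of_nat m = (of_nat (2 * n) :: complex)"
        using eqs(2) by (simp add: algebra_simps del: of_nat_eq_iff)
      ultimately have "n = 2 * m" "m = 2 * n"
        unfolding of_nat_eq_iff by blast+
      then show ?thesis
        using y(1) by (auto elim: fword.cases)
    qed simp
  qed
  from vec.span_mono[OF this]
  have "vec.span {y \<in> fwords v. wv (a, b) y} \<subseteq> vec.span {v}"
    by (simp only: vec.span_insert_0)
  moreover have "x \<in> vec.span {y \<in> fwords v. wv (a, b) y}"
    using weight_vector_in_span[OF assms(2)[unfolded gen_def] fwords_wv[OF assms(1)] assms(3)] .
  ultimately show ?thesis
    by blast
qed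

lemma weighted_gen:
  assumes "wv \<mu> v"
  shows "weighted (gen v)"
  unfolding weighted_def
proof -
  have "x \<in> gen v \<and> (\<exists>\<mu>. wv \<mu> x)" if "x \<in> fwords v" for x
    unfolding gen_def using fwords_wv[OF assms that] vec.span_base[OF that] by blast
  then have "fwords v \<subseteq> {x \<in> gen v. \<exists>\<mu>. wv \<mu> x}"
    by blast
  from vec.span_mono[OF this] show "gen v \<subseteq> vec.span {x \<in> gen v. \<exists>\<mu>. wv \<mu> x}"
    by (simp only: gen_def)
qed

text \<open>
  A non-zero submodule contains a highest weight vector \<open>r\<close>, of some weight \<open>\<Lambda> - m \<alpha>1 - n \<alpha>2\<close>. The Casimir
  operator acts by one scalar on the whole of \<open>gen v\<close>, so it takes the same value at the dominant
  weights of \<open>r\<close> and \<open>v\<close>. This forces the weights to agree, and then \<open>r\<close> is a multiple of \<open>v\<close>.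
\<close>

theorem irreducible_gen:
  assumes v: "hwv \<mu> v"
  shows "irreducible_submodule \<sigma> (gen v)"
proof -
  obtain a b where \<mu>: "\<mu> = (a, b)" by (cases \<mu>)
  note v = v[unfolded \<mu>]
  then have wv: "wv (a, b) v" and "v \<noteq> 0"
    by (auto simp: hwv_def)
  have "U = gen v" if U: "submodule \<sigma> U" "U \<subseteq> gen v" and "U \<noteq> {0}" for U
  proof -
    note D = submoduleD[OF U(1)]
    have wU: "weighted U"
      by (rule weighted_subspace[OF weighted_gen[OF wv] D(1) U(2) D(6) D(7)])
    obtain x where "x \<in> U" "x \<noteq> 0"
      using \<open>U \<noteq> {0}\<close> vec.subspace_0[OF D(1)] by blast
    obtain \<nu> r where r: "r \<in> U" "r \<noteq> 0" "wv \<nu> r"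
      and top: "\<And>\<kappa> y. y \<in> U \<Longrightarrow> wv \<kappa> y \<Longrightarrow> Re (fst \<nu> + snd \<nu>) < Re (fst \<kappa> + snd \<kappa>) \<Longrightarrow> y = 0"
      using exists_top_weight[OF wU \<open>x \<in> U\<close> \<open>x \<noteq> 0\<close>] by metis
    have hr: "hwv \<nu> r"
      using top_weight_imp_hwv[OF r D(2)[OF r(1)] D(3)[OF r(1)] top] .
    have "r \<in> vec.span {y \<in> fwords v. wv \<nu> y}"
      using weight_vector_in_span[OF _ fwords_wv[OF wv] r(3)] r(1) U(2) unfolding gen_def by blast
    then obtain y where y: "y \<in> fwords v" "wv \<nu> y" "y \<noteq> 0"
      using r(2) vec.span_mono[of "{y \<in> fwords v. wv \<nu> y}" "{0}"]
      unfolding vec.span_insert_0 vec.span_empty by blast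
    then obtain m n where mn: "fword v m n y"
      by blast
    have \<nu>: "\<nu> = (a - 2 * of_nat m + of_nat n, b + of_nat m - 2 * of_nat n)"
      using wv_unique[OF y(2) fword_wv[OF mn wv] y(3)] .
    obtain a' b' where \<nu>': "\<nu> = (a', b')" by (cases \<nu>)
    note hr = hr[unfolded \<nu>']
    obtain p q p' q' where nat: "a = of_nat p" "b = of_nat q" "a' = of_nat p'" "b' = of_nat q'"
      using hwv_dominant[OF v] hwv_dominant[OF hr] by (auto simp: Nats_def)
    have "r \<in> gen v"
      using r(1) U(2) by blast
    from casimir_gen[OF v this] casimir_hwv[OF hr] r(2)
    have cas: "a\<^sup>2 + a * b + b\<^sup>2 + 3 * (a + b) = a'\<^sup>2 + a' * b' + b'\<^sup>2 + 3 * (a' + b')"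
      by (metis vec.scale_cancel_right)
    have "int m = 0 \<and> int n = 0"
    proof (rule casimir_value_separates[of "int p" "int q" "int p'" "int q'"])
      have eqs: "a' = a - 2 * of_nat m + of_nat n" "b' = b + of_nat m - 2 * of_nat n"
        using \<nu> unfolding \<nu>' by blast+
      have "(of_int (int p') :: complex) = of_int (int p - 2 * int m + int n)"
        using eqs(1) unfolding nat by simp
      then show "int p' = int p - 2 * int m + int n"
        by (simp only: of_int_eq_iff)
      have "(of_int (int q') :: complex) = of_int (int q + int m - 2 * int n)"
        using eqs(2) unfolding nat by simp
      then show "int q' = int q + int m - 2 * int n"
        by (simp only: of_int_eq_iff)
      have "(of_int ((int p)\<^sup>2 + int p * int q + (int q)\<^sup>2 + 3 * (int p + int q)) :: complex)
          = of_int ((int p')\<^sup>2 + int p' * int q' + (int q')\<^sup>2 + 3 * (int p' + int q'))"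
        using cas unfolding nat by simp
      then show "(int p)\<^sup>2 + int p * int q + (int q)\<^sup>2 + 3 * (int p + int q)
          = (int p')\<^sup>2 + int p' * int q' + (int q')\<^sup>2 + 3 * (int p' + int q')"
        by (simp only: of_int_eq_iff)
    qed auto
    then have "\<nu> = (a, b)"
      using \<nu> by simp
    then have "r \<in> vec.span {v}"
      using gen_top_weight_space[OF wv \<open>r \<in> gen v\<close>] r(3) by simp
    then obtain c where "r = c *s v"
      by (auto simp: vec.span_singleton)
    then have "v = inverse c *s r"
      using r(2) by simp
    then have "v \<in> U"
      using D(1) r(1) by (auto intro: vec.subspace_scale)
    then show ?thesis
      using gen_minimal[OF U(1)] U(2) by blast
  qed
  moreover have "gen v \<noteq> {0}"
    using gen_base[of v] \<open>v \<noteq> 0\<close> by blast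
  ultimately show ?thesis
    using submodule_gen[OF assms] by (auto simp: irreducible_submodule_def)
qed

text \<open>
  Otherwise \<open>f2 v\<close> would be a highest weight vector whose weight has second coordinate \<open>-2\<close>.
\<close>

lemma hwv_zero_f2:
  assumes v: "hwv (a, 0) v"
  shows "f2 v = 0"
proof (rule ccontr)
  assume "f2 v \<noteq> 0"
  moreover have "wv (a + 1, -2) (f2 v)"
    using wv_root(4)[of a 0 v] v by (simp add: hwv_def)
  moreover have "e1 (f2 v) = 0" "e2 (f2 v) = 0"
    using v by (simp_all add: hwv_def wv_def commute_rules)
  ultimately have "hwv (a + 1, -2) (f2 v)"
    by (simp add: hwv_def)
  then have "(-2 :: complex) \<in> \<nat>"
    using hwv_dominant(2) by blast
  then obtain n where "(-2 :: complex) = of_nat n"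
    by (auto simp: Nats_def)
  then have "of_nat (n + 2) = (0 :: complex)"
    by (metis add.commute add.left_inverse of_nat_add of_nat_numeral add.right_inverse)
  then show False
    unfolding of_nat_eq_0_iff by simp
qed

lemma gen_UNIV:
  assumes "irreducible_submodule \<sigma> UNIV" "hwv \<mu> v"
  shows "gen v = UNIV"
  using assms irreducible_gen[OF assms(2)] by (auto simp: irreducible_submodule_def)

lemma gen_weight:
  assumes v: "wv (a, b) v" and y: "y \<in> gen v" "wv \<nu> y" "y \<noteq> 0"
  obtains m n where "\<nu> = (a - 2 * of_nat m + of_nat n, b + of_nat m - 2 * of_nat n)"
proof -
  have "y \<in> vec.span {x \<in> fwords v. wv \<nu> x}"
    using weight_vector_in_span[OF _ fwords_wv[OF v] y(2)] y(1) unfolding gen_def by blast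
  then obtain x where x: "x \<in> fwords v" "wv \<nu> x" "x \<noteq> 0"
    using y(3) vec.span_mono[of "{y \<in> fwords v. wv \<nu> y}" "{0}"]
    unfolding vec.span_insert_0 vec.span_empty by blast
  then obtain m n where "fword v m n x"
    by blast
  from wv_unique[OF x(2) fword_wv[OF this v] x(3)] show ?thesis
    by (rule that)
qed

end

section \<open>Dual modules and complete reducibility\<close>

text \<open>
  The bilinear form, without complex conjugation: column vectors also serve as linear functionals.
\<close>

definition pairing :: "complex^'n \<Rightarrow> complex^'n \<Rightarrow> complex" where
  "pairing u v = (\<Sum>i\<in>UNIV. u $ i * v $ i)"

lemma pairing_simps [simp]:
  "pairing (u + u') v = pairing u v + pairing u' v" "pairing u (v + v') = pairing u v + pairing u v'"
  "pairing (u - u') v = pairing u v - pairing u' v" "pairing u (v - v') = pairing u v - pairing u v'"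
  "pairing (c *s u) v = c * pairing u v" "pairing u (c *s v) = c * pairing u v"
  "pairing 0 v = 0" "pairing u 0 = 0"
  by (simp_all add: pairing_def algebra_simps sum.distrib sum_subtractf sum_distrib_left)

lemma pairing_commute: "pairing u v = pairing v u"
  by (simp add: pairing_def mult.commute)

lemma pairing_transpose: "pairing (transpose A *v u) v = pairing u (A *v v)"
proof -
  have "pairing (transpose A *v u) v = (\<Sum>i\<in>UNIV. \<Sum>j\<in>UNIV. A $ j $ i * u $ j * v $ i)"
    by (simp add: pairing_def vector_matrix_mult_def sum_distrib_left sum_distrib_right mult_ac)
  also have "\<dots> = (\<Sum>j\<in>UNIV. \<Sum>i\<in>UNIV. A $ j $ i * u $ j * v $ i)"
    by (rule sum.swap)
  also have "\<dots> = pairing u (A *v v)"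
    by (simp add: pairing_def matrix_vector_mult_def sum_distrib_left mult_ac)
  finally show ?thesis .
qed

lemma pairing_axis: "pairing u (axis i 1) = u $ i"
  by (simp add: pairing_def axis_def if_distrib [of "\<lambda>c. _ * c"] cong: if_cong)

lemma pairing_eqI: "(\<And>w. pairing x w = pairing y w) \<Longrightarrow> x = y"
  by (metis pairing_axis vec_eq_iff)

text \<open>
  Extend a basis of \<open>S\<close> by \<open>v\<close> and prescribe the values of a linear map on the resulting independent
  set; the functional is one row of the matrix of that map.
\<close>

lemma separating_functional:
  fixes S :: "(complex^'n) set"
  assumes S: "vec.subspace S" and v: "v \<notin> S"
  obtains u where "pairing u v = 1" "\<And>s. s \<in> S \<Longrightarrow> pairing u s = 0"
proof -
  obtain B where B: "B \<subseteq> S" "vec.independent B" "S \<subseteq> vec.span B"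
    using vec.maximal_independent_subset by blast
  have "vec.span B = S"
    using B vec.span_minimal[OF B(1) S] by blast
  then have ind: "vec.independent (insert v B)"
    using v B(2) vec.independent_insertI by blast
  fix k :: 'n
  obtain f :: "complex^'n \<Rightarrow> complex^'n" where f: "Vector_Spaces.linear (*s) (*s) f"
    "\<forall>x\<in>insert v B. f x = (if x = v then axis k 1 else 0)"
    using vec.linear_independent_extend[OF ind, of "\<lambda>x. if x = v then axis k 1 else 0"] by blast
  have fS: "f s = 0" if "s \<in> S" for s
  proof -
    have "\<forall>b\<in>B. f b = 0"
      using f(2) v B(1) by auto
    then show ?thesis
      using vec.linear_eq_0_on_span[OF f(1), of B s] \<open>vec.span B = S\<close> that by blast
  qed
  have P: "pairing (row k (matrix f)) x = f x $ k" for x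
  proof -
    have "pairing (row k (matrix f)) x = (matrix f *v x) $ k"
      by (simp add: pairing_def row_def matrix_vector_mult_def)
    then show ?thesis
      by (simp add: matrix_works[OF f(1)])
  qed
  have "pairing (row k (matrix f)) v = 1"
    using f(2) by (simp add: P)
  moreover have "pairing (row k (matrix f)) s = 0" if "s \<in> S" for s
    using fS[OF that] by (simp add: P)
  ultimately show ?thesis
    using that by blast
qed

definition annihilator :: "(complex^'n) set \<Rightarrow> (complex^'n) set" where
  "annihilator S = {v. \<forall>u\<in>S. pairing u v = 0}"

lemma subspace_annihilator: "vec.subspace (annihilator S)"
  by (simp add: vec.subspace_def annihilator_def)

lemma double_annihilator:
  assumes "vec.subspace S" "\<And>w. w \<in> annihilator S \<Longrightarrow> pairing t w = 0"
  shows "t \<in> S"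
proof (rule ccontr)
  assume "t \<notin> S"
  then obtain w where w: "pairing w t = 1" "\<And>s. s \<in> S \<Longrightarrow> pairing w s = 0"
    using separating_functional[OF assms(1)] by blast
  then have "w \<in> annihilator S"
    using pairing_commute[of _ w] by (simp add: annihilator_def)
  then show False
    using assms(2)[of w] w(1) pairing_commute[of w t] by simp
qed

text \<open>
  The contragredient module twisted by the Chevalley involution. Because of the twist, the
  transpose of a lowering operator acts as the corresponding raising operator, so that the dual of a
  highest weight module is again a highest weight module, with the same highest weight.
\<close>

definition dual_module :: "(complex^3^3 \<Rightarrow> complex^'n^'n) \<Rightarrow> complex^3^3 \<Rightarrow> complex^'n^'n" where
  "dual_module \<sigma> x = transpose (\<sigma> (transpose x))"

lemma dual_dual_module [simp]: "dual_module (dual_module \<sigma>) = \<sigma>"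
  by (simp add: dual_module_def fun_eq_iff)

lemma transpose_add: "transpose (A + B) = transpose A + transpose B"
  by (simp add: transpose_def vec_eq_iff)

lemma transpose_mat_mult: "transpose (mat c ** A) = mat c ** transpose (A :: complex^'n^'n)"
  by (simp add: vec_eq_iff transpose_def matrix_matrix_mult_def mat_def
      if_distrib [of "\<lambda>c. c * _"] cong: if_cong)

lemma transpose_lie_bracket: "transpose (lie_bracket A B) = lie_bracket (transpose B) (transpose A)"
proof -
  have "transpose (lie_bracket A B) = transpose (A ** B) - transpose (B ** A)"
    by (simp add: lie_bracket_def transpose_def vec_eq_iff)
  then show ?thesis
    by (simp add: lie_bracket_def matrix_transpose_mul)
qed

lemma sl3_module_dual:
  assumes "sl3_module \<sigma>"
  shows "sl3_module (dual_module \<sigma>)"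
  unfolding sl3_module_def dual_module_def
proof (intro conjI allI ballI)
  note m = assms[unfolded sl3_module_def]
  fix x y c assume x: "x \<in> sl3"
  show "transpose (\<sigma> (transpose (mat c ** x))) = mat c ** transpose (\<sigma> (transpose x))"
    using m sl3_closed(3)[OF x] by (metis transpose_mat_mult)
  assume y: "y \<in> sl3"
  note xy = sl3_closed(3)[OF x] sl3_closed(3)[OF y]
  show "transpose (\<sigma> (transpose (x + y))) = transpose (\<sigma> (transpose x)) + transpose (\<sigma> (transpose y))"
    using m xy by (metis transpose_add)
  show "transpose (\<sigma> (transpose (lie_bracket x y)))
      = lie_bracket (transpose (\<sigma> (transpose x))) (transpose (\<sigma> (transpose y)))"
    using m xy by (metis transpose_lie_bracket)
qed

context sl3_rep
begin

lemma submodule_annihilator: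
  assumes "submodule (dual_module \<sigma>) S"
  shows "submodule \<sigma> (annihilator S)"
  unfolding submodule_def
proof (intro conjI ballI subspace_annihilator)
  fix x w assume x: "x \<in> sl3" and w: "w \<in> annihilator S"
  have "pairing u (\<sigma> x *v w) = 0" if "u \<in> S" for u
  proof -
    have "dual_module \<sigma> (transpose x) *v u \<in> S"
      using assms sl3_closed(3)[OF x] that by (simp only: submodule_def)
    then have "pairing (dual_module \<sigma> (transpose x) *v u) w = 0"
      using w by (simp add: annihilator_def)
    then show ?thesis
      by (simp only: dual_module_def transpose_transpose pairing_transpose)
  qed
  then show "\<sigma> x *v w \<in> annihilator S"
    by (simp add: annihilator_def)
qed

lemma submodule_Int: "submodule \<sigma> S \<Longrightarrow> submodule \<sigma> T \<Longrightarrow> submodule \<sigma> (S \<inter> T)"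
  by (simp add: submodule_def vec.subspace_inter)

lemma submodule_sum:
  assumes "submodule \<sigma> S" "submodule \<sigma> T"
  shows "submodule \<sigma> {x + y |x y. x \<in> S \<and> y \<in> T}"
  unfolding submodule_def
proof (intro conjI ballI)
  show "vec.subspace {x + y |x y. x \<in> S \<and> y \<in> T}"
    using assms by (intro vec.subspace_sums) (simp_all add: submodule_def)
  fix a w assume "a \<in> sl3" "w \<in> {x + y |x y. x \<in> S \<and> y \<in> T}"
  then show "\<sigma> a *v w \<in> {x + y |x y. x \<in> S \<and> y \<in> T}"
    using assms unfolding submodule_def by (force simp: vec.add)
qed

text \<open>
  A vector \<open>v\<close> of top weight \<open>\<mu>\<close> in a direct summand \<open>K\<close> is detected by a highest weight vector of the dual
  module. The functional is chosen to vanish on the complement \<open>P\<close>, on all weight vectors of \<open>K\<close> of weight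
  other than \<open>\<mu>\<close>, and to be 1 at \<open>v\<close>. It is then a weight vector, and it vanishes on every \<open>f1 k\<close> and
  \<open>f2 k\<close> with \<open>k\<close> in \<open>K\<close>: such a vector could only have weight \<open>\<mu>\<close> if \<open>k\<close> had a weight above the top one.
\<close>

lemma exists_dual_hwv:
  assumes P: "submodule \<sigma> P" and K: "submodule \<sigma> K"
    and PK: "P \<inter> K = {0}" "\<And>x. \<exists>p\<in>P. \<exists>k\<in>K. x = p + k"
    and wK: "weighted K" and v: "v \<in> K" "v \<noteq> 0" "wv \<mu> v"
    and top: "\<And>\<nu> y. y \<in> K \<Longrightarrow> wv \<nu> y \<Longrightarrow> Re (fst \<mu> + snd \<mu>) < Re (fst \<nu> + snd \<nu>) \<Longrightarrow> y = 0"
  obtains u where "pairing u v = 1" "\<And>p. p \<in> P \<Longrightarrow> pairing u p = 0" "sl3_rep.hwv (dual_module \<sigma>) \<mu> u"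
proof -
  note KD = submoduleD[OF K] and PD = submoduleD[OF P]
  define X where "X = {x \<in> K. \<exists>\<nu>. \<nu> \<noteq> \<mu> \<and> wv \<nu> x}"
  define Y where "Y = {p + x |p x. p \<in> P \<and> x \<in> vec.span X}"
  have Y: "vec.subspace Y"
    unfolding Y_def by (rule vec.subspace_sums[OF PD(1) vec.subspace_span])
  have spanX: "vec.span X \<subseteq> K"
    using vec.span_minimal[OF _ KD(1), of X] by (auto simp: X_def)
  have "v \<notin> Y"
  proof
    assume "v \<in> Y"
    then obtain p y where py: "v = p + y" "p \<in> P" "y \<in> vec.span X"
      by (auto simp: Y_def)
    have "v - y \<in> K"
      using spanX py(3) by (intro vec.subspace_diff[OF KD(1) v(1)]) blast
    then have "p \<in> P \<inter> K"
      using py by simp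
    then have "v \<in> vec.span X"
      using py PK(1) by simp
    moreover have "\<exists>\<nu>. wv \<nu> b" if "b \<in> X" for b
      using that by (auto simp: X_def)
    ultimately have "v \<in> vec.span {b \<in> X. wv \<mu> b}"
      using weight_vector_in_span[OF _ _ v(3)] by blast
    moreover have "{b \<in> X. wv \<mu> b} \<subseteq> {0}"
      using wv_unique unfolding X_def by blast
    ultimately show False
      using vec.span_mono[of "{b \<in> X. wv \<mu> b}" "{0}"] v(2)
      unfolding vec.span_insert_0 vec.span_empty by blast
  qed
  then obtain u where u: "pairing u v = 1" "\<And>y. y \<in> Y \<Longrightarrow> pairing u y = 0"
    using separating_functional[OF Y] by blast
  have uP: "pairing u p = 0" if "p \<in> P" for p
    using u(2)[of "p + 0"] that vec.span_zero unfolding Y_def by force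
  have uX: "pairing u y = 0" if "y \<in> K" "wv \<nu> y" "\<nu> \<noteq> \<mu>" for y \<nu>
  proof -
    have "y \<in> vec.span X"
      using that unfolding X_def by (intro vec.span_base) blast
    then have "0 + y \<in> Y"
      unfolding Y_def using vec.subspace_0[OF PD(1)] by blast
    then show ?thesis
      using u(2) by simp
  qed

  interpret D: sl3_rep "dual_module \<sigma>"
    by (intro sl3_rep.intro sl3_module_dual module)
  have eigen: "transpose A *v u = c *s u"
    if AP: "\<And>p. p \<in> P \<Longrightarrow> A *v p \<in> P"
      and AK: "\<And>k \<nu>. k \<in> K \<Longrightarrow> wv \<nu> k \<Longrightarrow> pairing u (A *v k) = c * pairing u k" for A c
  proof (rule pairing_eqI)
    fix w
    obtain p k where w: "w = p + k" "p \<in> P" "k \<in> K"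
      using PK(2) by blast
    have "k \<in> vec.span {x \<in> K. \<exists>\<nu>. wv \<nu> x}"
      using w(3) wK unfolding weighted_def by blast
    then have "pairing u (A *v k) = c * pairing u k"
    proof (induction rule: vec.span_induct_alt)
      case base
      then show ?case by simp
    next
      case (step d b y)
      then have "pairing u (A *v b) = c * pairing u b"
        using AK by blast
      then show ?case
        using step.IH by (simp add: vec.add vec.scale algebra_simps)
    qed
    then show "pairing (transpose A *v u) w = pairing (c *s u) w"
      unfolding pairing_transpose using w uP AP by (simp add: vec.add)
  qed
  have hu: "D.hwv \<mu> u"
    unfolding D.hwv_def D.wv_def
  proof (intro conjI)
    show "u \<noteq> 0"
      using u(1) by auto
    have scal: "pairing u (c' *s k) = c * pairing u k" if "k \<in> K" "wv \<nu> k" "\<nu> = \<mu> \<Longrightarrow> c' = c" for c c' k \<nu>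
      using uX[OF that(1,2)] that(3) by (cases "\<nu> = \<mu>") auto
    show "dual_module \<sigma> H1 *v u = fst \<mu> *s u"
      unfolding dual_module_def transpose_root_basis
    proof (rule eigen[OF PD(6)])
      fix k \<nu> assume k: "k \<in> K" "wv \<nu> k"
      show "pairing u (h1 k) = fst \<mu> * pairing u k"
        using scal[OF k, of "fst \<nu>" "fst \<mu>"] k(2) unfolding wv_def by metis
    qed
    show "dual_module \<sigma> H2 *v u = snd \<mu> *s u"
      unfolding dual_module_def transpose_root_basis
    proof (rule eigen[OF PD(7)])
      fix k \<nu> assume k: "k \<in> K" "wv \<nu> k"
      show "pairing u (h2 k) = snd \<mu> * pairing u k"
        using scal[OF k, of "snd \<nu>" "snd \<mu>"] k(2) unfolding wv_def by metis
    qed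
    \<comment> \<open>If \<open>k\<close> is lowered into weight \<open>\<mu>\<close>, its own weight lies above the top weight, so \<open>k = 0\<close>.\<close>
    have lower: "pairing u (\<sigma> F *v k) = 0 * pairing u k"
      if "\<sigma> F *v k \<in> K" "k \<in> K" "wv \<nu> k" "wv (fst \<nu> + s, snd \<nu> + t) (\<sigma> F *v k)" "Re (s + t) < 0"
      for F k \<nu> s t
    proof (cases "(fst \<nu> + s, snd \<nu> + t) = \<mu>")
      case True
      then have "fst \<mu> + snd \<mu> = fst \<nu> + snd \<nu> + (s + t)"
        by auto
      then have "Re (fst \<mu> + snd \<mu>) < Re (fst \<nu> + snd \<nu>)"
        using that(5) by simp
      then have "k = 0"
        using top that(2,3) by blast
      then show ?thesis by simp
    next
      case False
      then show ?thesis
        using uX[OF that(1,4)] by simp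
    qed
    have "transpose (\<sigma> F1) *v u = 0 *s u"
    proof (rule eigen[OF PD(4)])
      fix k \<nu> assume k: "k \<in> K" "wv \<nu> k"
      show "pairing u (f1 k) = 0 * pairing u k"
        using lower[of F1 k \<nu> "-2" 1] KD(4)[OF k(1)] k wv_root(3)[of "fst \<nu>" "snd \<nu>" k] by simp
    qed
    then show "dual_module \<sigma> E1 *v u = 0"
      by (simp only: dual_module_def transpose_root_basis vec.scale_zero_left)
    have "transpose (\<sigma> F2) *v u = 0 *s u"
    proof (rule eigen[OF PD(5)])
      fix k \<nu> assume k: "k \<in> K" "wv \<nu> k"
      show "pairing u (f2 k) = 0 * pairing u k"
        using lower[of F2 k \<nu> 1 "-2"] KD(5)[OF k(1)] k wv_root(4)[of "fst \<nu>" "snd \<nu>" k] by simp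
    qed
    then show "dual_module \<sigma> E2 *v u = 0"
      by (simp only: dual_module_def transpose_root_basis vec.scale_zero_left)
  qed
  show ?thesis
    using that u(1) uP hu by blast
qed

lemma dual_hwv:
  assumes irr: "irreducible_submodule \<sigma> UNIV" and w: "hwv (a, b) w"
  obtains u where "pairing u w = 1" "sl3_rep.hwv (dual_module \<sigma>) (a, b) u"
proof -
  have wv: "wv (a, b) w" and w0: "w \<noteq> 0"
    using w by (auto simp: hwv_def)
  have U: "gen w = UNIV"
    by (rule gen_UNIV[OF irr w])
  have weighted: "weighted UNIV"
    using weighted_gen[OF wv] U by simp
  have top: "y = 0" if y: "wv \<nu> y" and gt: "Re (fst (a, b) + snd (a, b)) < Re (fst \<nu> + snd \<nu>)" for \<nu> y
  proof (rule ccontr)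
    assume "y \<noteq> 0"
    then obtain m n where "\<nu> = (a - 2 * of_nat m + of_nat n, b + of_nat m - 2 * of_nat n)"
      using gen_weight[OF wv _ y] U by blast
    then show False
      using gt by simp
  qed
  have zero: "submodule \<sigma> {0}" "submodule \<sigma> UNIV"
    by (auto simp: submodule_def)
  show ?thesis
    by (rule exists_dual_hwv[OF zero _ _ weighted UNIV_I w0 wv top that]) auto
qed

text \<open>
  Let \<open>v\<close> be of top weight in \<open>K\<close> and \<open>u\<close> the dual highest weight vector with \<open>pairing u v = 1\<close>. Both \<open>N\<close>,
  generated by \<open>v\<close>, and \<open>Ns\<close>, generated by \<open>u\<close> in the dual module, are irreducible. Neither annihilates
  the other, so \<open>N\<close> meets the annihilator of \<open>Ns\<close> trivially and vice versa; the second statement says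
  that \<open>N\<close> and the annihilator of \<open>Ns\<close> together span the space. The annihilator is therefore a submodule
  complementary to \<open>N\<close>, and its intersection with \<open>K\<close> is the wanted \<open>K'\<close>.
\<close>

lemma exists_irreducible_summand:
  assumes P: "submodule \<sigma> P" and K: "submodule \<sigma> K"
    and PK: "P \<inter> K = {0}" "\<And>x. \<exists>p\<in>P. \<exists>k\<in>K. x = p + k"
    and "weighted UNIV" "K \<noteq> {0}"
  obtains N K' where "irreducible_submodule \<sigma> N" "N \<subseteq> K" "submodule \<sigma> K'" "K' \<subseteq> K"
    "N \<inter> K' = {0}" "\<And>k. k \<in> K \<Longrightarrow> \<exists>n\<in>N. \<exists>k'\<in>K'. k = n + k'"
proof -
  note KD = submoduleD[OF K]
  have wK: "weighted K"
    by (rule weighted_subspace[OF assms(5) KD(1) subset_UNIV KD(6,7)])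
  obtain x where x: "x \<in> K" "x \<noteq> 0"
    using \<open>K \<noteq> {0}\<close> vec.subspace_0[OF KD(1)] by blast
  obtain \<mu> v where v: "v \<in> K" "v \<noteq> 0" "wv \<mu> v"
    and top: "\<And>\<nu> y. y \<in> K \<Longrightarrow> wv \<nu> y \<Longrightarrow> Re (fst \<mu> + snd \<mu>) < Re (fst \<nu> + snd \<nu>) \<Longrightarrow> y = 0"
    using exists_top_weight[OF wK x] by metis
  have hv: "hwv \<mu> v"
    by (rule top_weight_imp_hwv[OF v KD(2)[OF v(1)] KD(3)[OF v(1)] top])
  obtain u where u: "pairing u v = 1" and hu: "sl3_rep.hwv (dual_module \<sigma>) \<mu> u"
    using exists_dual_hwv[OF P K PK wK v] top by metis
  interpret D: sl3_rep "dual_module \<sigma>"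
    by (intro sl3_rep.intro sl3_module_dual module)
  define N where "N = gen v"
  define Ns where "Ns = D.gen u"
  have N: "irreducible_submodule \<sigma> N" "submodule \<sigma> N" "v \<in> N"
    unfolding N_def by (fact irreducible_gen[OF hv] submodule_gen[OF hv] gen_base)+
  have Ns: "irreducible_submodule (dual_module \<sigma>) Ns" "submodule (dual_module \<sigma>) Ns" "u \<in> Ns"
    unfolding Ns_def by (fact D.irreducible_gen[OF hu] D.submodule_gen[OF hu] D.gen_base)+
  have aNs: "submodule \<sigma> (annihilator Ns)"
    by (rule submodule_annihilator[OF Ns(2)])
  have aN: "submodule (dual_module \<sigma>) (annihilator N)"
    by (rule D.submodule_annihilator) (simp add: N(2))
  define K' where "K' = K \<inter> annihilator Ns"
  have K': "submodule \<sigma> K'"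
    unfolding K'_def by (rule submodule_Int[OF K aNs])
  have NK: "N \<subseteq> K"
    unfolding N_def by (rule gen_minimal[OF K v(1)])
  have "v \<notin> annihilator Ns"
    using u Ns(3) zero_neq_one unfolding annihilator_def by fastforce
  then have "N \<inter> annihilator Ns \<noteq> N"
    using N(3) by blast
  then have trivial: "N \<inter> annihilator Ns = {0}"
    using N(1) submodule_Int[OF N(2) aNs] unfolding irreducible_submodule_def by blast
  have "u \<notin> annihilator N"
    using u N(3) pairing_commute[of u v] zero_neq_one unfolding annihilator_def by fastforce
  then have "Ns \<inter> annihilator N \<noteq> Ns"
    using Ns(3) by blast
  then have trivial': "Ns \<inter> annihilator N = {0}"
    using Ns(1) D.submodule_Int[OF Ns(2) aN] unfolding irreducible_submodule_def by blast
  define T where "T = {n + y |n y. n \<in> N \<and> y \<in> annihilator Ns}"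
  have "x \<in> T" for x
  proof (rule ccontr)
    assume "x \<notin> T"
    moreover have "vec.subspace T"
      unfolding T_def using submoduleD(1)[OF N(2)] subspace_annihilator by (rule vec.subspace_sums)
    ultimately obtain t where t: "pairing t x = 1" "\<And>y. y \<in> T \<Longrightarrow> pairing t y = 0"
      using separating_functional by blast
    have tN: "pairing t n = 0" if "n \<in> N" for n
    proof -
      have "n + 0 \<in> T"
        unfolding T_def using that vec.subspace_0[OF subspace_annihilator] by blast
      then show ?thesis using t(2) by simp
    qed
    have tA: "pairing t y = 0" if "y \<in> annihilator Ns" for y
    proof -
      have "0 + y \<in> T"
        unfolding T_def using that vec.subspace_0[OF submoduleD(1)[OF N(2)]] by blast
      then show ?thesis using t(2) by simp
    qed
    \<comment> \<open>A functional \<open>t\<close> vanishing on \<open>N\<close> and on the annihilator of \<open>Ns\<close> lies in \<open>Ns\<close>, hence in the trivial intersection.\<close>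
    have "t \<in> Ns"
      using double_annihilator[OF D.submoduleD(1)[OF Ns(2)] tA] .
    moreover have "t \<in> annihilator N"
      using tN pairing_commute[of t] by (simp add: annihilator_def)
    ultimately have "t = 0"
      using trivial' by blast
    then show False
      using t(1) by simp
  qed
  then have split: "\<exists>n\<in>N. \<exists>k'\<in>K'. k = n + k'" if k: "k \<in> K" for k
  proof -
    obtain n y where ny: "k = n + y" "n \<in> N" "y \<in> annihilator Ns"
      using \<open>\<And>x. x \<in> T\<close>[of k] unfolding T_def by blast
    have "k - n \<in> K"
      using NK ny(2) by (intro vec.subspace_diff[OF KD(1) k]) blast
    then show ?thesis
      using ny unfolding K'_def by force
  qed
  have "N \<inter> K' = {0}"
    using trivial vec.subspace_0[OF submoduleD(1)[OF K']] NK unfolding K'_def by blast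
  then show ?thesis
    using that[OF N(1) NK K' _ _ split] unfolding K'_def by blast
qed

definition direct_decomposition :: "(complex^'n) set set \<Rightarrow> (complex^'n) set \<Rightarrow> bool" where
  "direct_decomposition \<W> K \<longleftrightarrow> finite \<W> \<and> (\<forall>W\<in>\<W>. irreducible_submodule \<sigma> W \<and> W \<subseteq> K) \<and>
     (\<forall>k\<in>K. \<exists>!u. u \<in> (\<Pi>\<^sub>E W\<in>\<W>. W) \<and> (\<Sum>W\<in>\<W>. u W) = k)"

lemma direct_decomposition_insert:
  assumes K': "submodule \<sigma> K'" and dec: "direct_decomposition \<W> K'"
    and N: "irreducible_submodule \<sigma> N" "N \<subseteq> K" and "K' \<subseteq> K" and NK': "N \<inter> K' = {0}"
    and split: "\<And>k. k \<in> K \<Longrightarrow> \<exists>n\<in>N. \<exists>k'\<in>K'. k = n + k'"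
  shows "direct_decomposition (insert N \<W>) K"
proof -
  have W: "finite \<W>" "\<And>W. W \<in> \<W> \<Longrightarrow> irreducible_submodule \<sigma> W" "\<And>W. W \<in> \<W> \<Longrightarrow> W \<subseteq> K'"
    and uni: "\<And>k. k \<in> K' \<Longrightarrow> \<exists>!u. u \<in> (\<Pi>\<^sub>E W\<in>\<W>. W) \<and> (\<Sum>W\<in>\<W>. u W) = k"
    using dec unfolding direct_decomposition_def by blast+
  have subN: "vec.subspace N" and "N \<noteq> {0}"
    using N(1) by (auto simp: irreducible_submodule_def submodule_def)
  have subK': "vec.subspace K'"
    using K' by (simp add: submodule_def)
  have "N \<notin> \<W>"
    using W(3) NK' \<open>N \<noteq> {0}\<close> by blast
  have restr: "u N \<in> N \<and> restrict u \<W> \<in> (\<Pi>\<^sub>E W\<in>\<W>. W) \<and> (\<Sum>W\<in>\<W>. restrict u \<W> W) \<in> K' \<and>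
      (\<Sum>W\<in>insert N \<W>. u W) = u N + (\<Sum>W\<in>\<W>. restrict u \<W> W)"
    if u: "u \<in> (\<Pi>\<^sub>E W\<in>insert N \<W>. W)" for u
  proof (intro conjI)
    have mem: "u W \<in> W" if "W \<in> insert N \<W>" for W
      using u that by (rule PiE_mem)
    then show "u N \<in> N" "restrict u \<W> \<in> (\<Pi>\<^sub>E W\<in>\<W>. W)"
      by auto
    have "(\<Sum>W\<in>\<W>. u W) \<in> K'"
      using mem W(3) by (intro vec.subspace_sum[OF subK']) blast
    then show "(\<Sum>W\<in>\<W>. restrict u \<W> W) \<in> K'"
      by simp
    show "(\<Sum>W\<in>insert N \<W>. u W) = u N + (\<Sum>W\<in>\<W>. restrict u \<W> W)"
      using W(1) \<open>N \<notin> \<W>\<close> by simp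
  qed
  have "\<exists>!u. u \<in> (\<Pi>\<^sub>E W\<in>insert N \<W>. W) \<and> (\<Sum>W\<in>insert N \<W>. u W) = k" if k: "k \<in> K" for k
  proof (rule ex_ex1I)
    obtain n k' where nk: "n \<in> N" "k' \<in> K'" "k = n + k'"
      using split[OF k] by blast
    obtain u where u: "u \<in> (\<Pi>\<^sub>E W\<in>\<W>. W)" "(\<Sum>W\<in>\<W>. u W) = k'"
      using uni[OF nk(2)] by blast
    have "u(N := n) \<in> (\<Pi>\<^sub>E W\<in>insert N \<W>. W)"
      using u(1) nk(1) by (simp add: PiE_fun_upd)
    moreover have "(\<Sum>W\<in>\<W>. (u(N := n)) W) = (\<Sum>W\<in>\<W>. u W)"
      using \<open>N \<notin> \<W>\<close> by (intro sum.cong) auto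
    then have "(\<Sum>W\<in>insert N \<W>. (u(N := n)) W) = k"
      using W(1) \<open>N \<notin> \<W>\<close> u(2) nk(3) by simp
    ultimately show "\<exists>u. u \<in> (\<Pi>\<^sub>E W\<in>insert N \<W>. W) \<and> (\<Sum>W\<in>insert N \<W>. u W) = k"
      by blast
  next
    fix u u'
    assume u: "u \<in> (\<Pi>\<^sub>E W\<in>insert N \<W>. W) \<and> (\<Sum>W\<in>insert N \<W>. u W) = k"
      and u': "u' \<in> (\<Pi>\<^sub>E W\<in>insert N \<W>. W) \<and> (\<Sum>W\<in>insert N \<W>. u' W) = k"
    note r = restr[OF conjunct1[OF u]] and r' = restr[OF conjunct1[OF u']]
    let ?s = "\<Sum>W\<in>\<W>. restrict u \<W> W" and ?s' = "\<Sum>W\<in>\<W>. restrict u' \<W> W"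
    have sum_eq: "u N + ?s = u' N + ?s'"
      using u u' r r' by argo
    then have eq: "u N - u' N = ?s' - ?s"
      by (simp add: algebra_simps)
    have "u N - u' N \<in> N"
      using r r' by (intro vec.subspace_diff[OF subN]) blast+
    moreover have "u N - u' N \<in> K'"
      unfolding eq using r r' by (intro vec.subspace_diff[OF subK']) blast+
    ultimately have "u N - u' N = 0"
      using NK' by blast
    then have "u N = u' N"
      by (simp only: right_minus_eq)
    moreover have "?s' = ?s"
      using \<open>u N - u' N = 0\<close> unfolding eq by (simp only: right_minus_eq)
    ultimately have "restrict u \<W> = restrict u' \<W>"
      using uni[of ?s] r r' by blast
    then have "u W = u' W" if "W \<in> insert N \<W>" for W
      using that \<open>u N = u' N\<close> by (metis insertE restrict_apply')
    then show "u = u'"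
      using u u' by (intro PiE_ext[of u _ _ u']) auto
  qed
  moreover have "irreducible_submodule \<sigma> W \<and> W \<subseteq> K" if "W \<in> insert N \<W>" for W
    using that W(2,3) N \<open>K' \<subseteq> K\<close> by blast
  ultimately show ?thesis
    using W(1) unfolding direct_decomposition_def by (intro conjI ballI) simp_all
qed

text \<open>
  Split off irreducible summands one at a time. The complement \<open>P\<close> of the part \<open>K\<close> that remains is
  carried along in the induction, since the functional of \<open>exists_dual_hwv\<close> lives on the whole space.
\<close>

theorem complete_reducibility:
  assumes w: "weighted UNIV"
  shows "\<exists>\<W>. direct_decomposition \<W> UNIV"
proof -
  have "\<exists>\<W>. direct_decomposition \<W> K"
    if "submodule \<sigma> P" "submodule \<sigma> K" "P \<inter> K = {0}" "\<And>x. \<exists>p\<in>P. \<exists>k\<in>K. x = p + k" for P K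
    using that
  proof (induction "vec.dim K" arbitrary: P K rule: less_induct)
    case less
    note PD = submoduleD[OF less.prems(1)]
    show ?case
    proof (cases "K = {0}")
      case True
      have "direct_decomposition {} {0}"
        by (auto simp: direct_decomposition_def)
      then show ?thesis
        using True by blast
    next
      case False
      obtain N K' where N: "irreducible_submodule \<sigma> N" "N \<subseteq> K"
        and K': "submodule \<sigma> K'" "K' \<subseteq> K"
        and NK': "N \<inter> K' = {0}" "\<And>k. k \<in> K \<Longrightarrow> \<exists>n\<in>N. \<exists>k'\<in>K'. k = n + k'"
        using exists_irreducible_summand[OF less.prems w False] by metis
      have N': "submodule \<sigma> N" "N \<noteq> {0}"
        using N(1) by (auto simp: irreducible_submodule_def)
      have "K' \<noteq> K"
        using N(2) N'(2) NK'(1) by blast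
      moreover have "vec.dim K' \<le> vec.dim K"
        using K'(2) by (rule vec.dim_subset)
      ultimately have "vec.dim K' < vec.dim K"
        using vec.subspace_dim_equal[OF submoduleD(1)[OF K'(1)] submoduleD(1)[OF less.prems(2)] K'(2)]
        by linarith
      \<comment> \<open>The summand split off from \<open>K\<close> joins the complement.\<close>
      moreover define Q where "Q = {p + n |p n. p \<in> P \<and> n \<in> N}"
      have "submodule \<sigma> Q"
        unfolding Q_def by (rule submodule_sum[OF less.prems(1) N'(1)])
      moreover have "Q \<inter> K' = {0}"
      proof
        show "Q \<inter> K' \<subseteq> {0}"
        proof
          fix x assume x: "x \<in> Q \<inter> K'"
          then obtain p n where pn: "x = p + n" "p \<in> P" "n \<in> N"
            by (auto simp: Q_def)
          have "x - n \<in> K"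
            using x pn(3) K'(2) N(2) by (intro vec.subspace_diff[OF submoduleD(1)[OF less.prems(2)]]) auto
          then have "p = 0"
            using pn less.prems(3) by auto
          then show "x \<in> {0}"
            using x pn NK'(1) by auto
        qed
        have "0 + 0 \<in> Q"
          unfolding Q_def using vec.subspace_0[OF PD(1)] vec.subspace_0[OF submoduleD(1)[OF N'(1)]]
          by blast
        then show "{0} \<subseteq> Q \<inter> K'"
          using vec.subspace_0[OF submoduleD(1)[OF K'(1)]] by simp
      qed
      moreover have "\<exists>q\<in>Q. \<exists>k\<in>K'. x = q + k" for x
      proof -
        obtain p k where pk: "p \<in> P" "k \<in> K" "x = p + k"
          using less.prems(4) by blast
        obtain n k' where "n \<in> N" "k' \<in> K'" "k = n + k'"
          using NK'(2)[OF pk(2)] by blast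
        then show ?thesis
          using pk unfolding Q_def by (metis (mono_tags, lifting) add.assoc mem_Collect_eq)
      qed
      ultimately obtain \<W> where "direct_decomposition \<W> K'"
        using less.hyps[OF _ _ K'(1)] by metis
      then show ?thesis
        using direct_decomposition_insert[OF K'(1) _ N K'(2) NK'] by blast
    qed
  qed
  moreover have "submodule \<sigma> {0}" "submodule \<sigma> UNIV"
    by (auto simp: submodule_def)
  ultimately show ?thesis
    by force
qed

text \<open>
  The matrix \<open>\<sigma> x\<close> preserves every summand. Both sides, taken over all \<open>W\<close>, decompose the same vector, and such a decomposition is unique.
\<close>

lemma component_eigenvector:
  assumes dec: "direct_decomposition \<W> UNIV" and u: "u \<in> (\<Pi>\<^sub>E W\<in>\<W>. W)"
    and eig: "\<sigma> x *v (\<Sum>W\<in>\<W>. u W) = c *s (\<Sum>W\<in>\<W>. u W)" and x: "x \<in> sl3" and W: "W \<in> \<W>"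
  shows "\<sigma> x *v u W = c *s u W"
proof -
  define d where "d = (\<lambda>W\<in>\<W>. \<sigma> x *v u W - c *s u W)"
  have sub: "vec.subspace W" "\<And>w. w \<in> W \<Longrightarrow> \<sigma> x *v w \<in> W" if "W \<in> \<W>" for W
    using dec that x by (auto simp: direct_decomposition_def irreducible_submodule_def submodule_def)
  have "\<sigma> x *v u W - c *s u W \<in> W" if W: "W \<in> \<W>" for W
    using PiE_mem[OF u W] sub[OF W] by (simp add: vec.subspace_diff vec.subspace_scale)
  then have d: "d \<in> (\<Pi>\<^sub>E W\<in>\<W>. W)"
    unfolding d_def by simp
  have "(\<Sum>W\<in>\<W>. d W) = (\<Sum>W\<in>\<W>. \<sigma> x *v u W - c *s u W)"
    by (simp add: d_def)
  also have "\<dots> = 0"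
    using eig by (simp add: vec.sum vec.scale_sum_right sum_subtractf)
  finally have d0: "(\<Sum>W\<in>\<W>. d W) = 0" .
  have z: "(\<lambda>W\<in>\<W>. 0) \<in> (\<Pi>\<^sub>E W\<in>\<W>. W)" "(\<Sum>W\<in>\<W>. (\<lambda>W\<in>\<W>. 0) W) = (0 :: complex^'n)"
    using sub by (auto intro: vec.subspace_0)
  have "\<exists>!u. u \<in> (\<Pi>\<^sub>E W\<in>\<W>. W) \<and> (\<Sum>W\<in>\<W>. u W) = 0"
    using dec unfolding direct_decomposition_def by blast
  then have "d = (\<lambda>W\<in>\<W>. 0)"
    using d d0 z by blast
  then have "d W = 0"
    using W by simp
  then show ?thesis
    using W by (simp add: d_def)
qed

end

section \<open>Uniqueness of the irreducible module with a given highest weight\<close>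

text \<open>
  It is enough to verify the module axioms on a spanning set, such as the pure tensors.
\<close>

lemma sl3_moduleI:
  fixes \<sigma> :: "complex^3^3 \<Rightarrow> complex^'n^'n"
  assumes T: "vec.span T = UNIV"
    and "\<And>x y v. x \<in> sl3 \<Longrightarrow> y \<in> sl3 \<Longrightarrow> v \<in> T \<Longrightarrow> \<sigma> (x + y) *v v = \<sigma> x *v v + \<sigma> y *v v"
    and "\<And>c x v. x \<in> sl3 \<Longrightarrow> v \<in> T \<Longrightarrow> \<sigma> (mat c ** x) *v v = c *s (\<sigma> x *v v)"
    and "\<And>x y v. x \<in> sl3 \<Longrightarrow> y \<in> sl3 \<Longrightarrow> v \<in> T \<Longrightarrow>
        \<sigma> (lie_bracket x y) *v v = \<sigma> x *v (\<sigma> y *v v) - \<sigma> y *v (\<sigma> x *v v)"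
  shows "sl3_module \<sigma>"
proof -
  have eq: "A = B" if "\<And>v. v \<in> T \<Longrightarrow> A *v v = B *v v" for A B :: "complex^'n^'n"
  proof -
    have "A *v v = B *v v" if "v \<in> vec.span T" for v
      using that
    proof (induction rule: vec.span_induct_alt)
      case (step c x y)
      then show ?case
        using \<open>\<And>v. v \<in> T \<Longrightarrow> A *v v = B *v v\<close> by (simp add: vec.add vec.scale)
    qed simp
    then show ?thesis
      using T by (simp add: matrix_eq)
  qed
  show ?thesis
    unfolding sl3_module_def
    by (intro conjI ballI allI eq)
       (simp_all add: assms(2,3) assms(4)[unfolded lie_bracket_def] matrix_vector_mult_add_rdistrib scalar_mult_vector lie_bracket_def
         matrix_vector_mult_diff_rdistrib flip: matrix_vector_mul_assoc)
qed

definition pack :: "complex^'n::finite \<Rightarrow> complex^'m::finite \<Rightarrow> complex^('n + 'm)" where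
  "pack v w = (\<chi> p. case p of Inl i \<Rightarrow> v $ i | Inr j \<Rightarrow> w $ j)"

definition pleft :: "complex^('n::finite + 'm::finite) \<Rightarrow> complex^'n" where "pleft x = (\<chi> i. x $ Inl i)"
definition pright :: "complex^('n::finite + 'm::finite) \<Rightarrow> complex^'m" where "pright x = (\<chi> j. x $ Inr j)"

lemma pack_simps [simp]:
  "pleft (pack v w) = v" "pright (pack v w) = w" "pack (pleft x) (pright x) = x"
  by (simp_all add: pack_def pleft_def pright_def vec_eq_iff split: sum.split)

lemma pack_linear:
  "pack v w + pack v' w' = pack (v + v') (w + w')" "c *s pack v w = pack (c *s v) (c *s w)"
  "pack v w - pack v' w' = pack (v - v') (w - w')" "pack 0 0 = 0"
  by (simp_all add: pack_def vec_eq_iff split: sum.split)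

lemma proj_linear [simp]:
  "pleft (x + y) = pleft x + pleft y" "pleft (c *s x) = c *s pleft x" "pleft 0 = 0"
  "pleft (x - y) = pleft x - pleft y" "pright (x - y) = pright x - pright y"
  "pright (x + y) = pright x + pright y" "pright (c *s x) = c *s pright x" "pright 0 = 0"
  by (simp_all add: pleft_def pright_def vec_eq_iff)

definition sum_module ::
    "(complex^3^3 \<Rightarrow> complex^'n^'n) \<Rightarrow> (complex^3^3 \<Rightarrow> complex^'m^'m) \<Rightarrow>
     complex^3^3 \<Rightarrow> complex^('n::finite + 'm::finite)^('n + 'm)" where
  "sum_module \<rho> \<sigma> x = (\<chi> p q. case p of
       Inl i \<Rightarrow> (case q of Inl k \<Rightarrow> \<rho> x $ i $ k | Inr l \<Rightarrow> 0)
     | Inr j \<Rightarrow> (case q of Inl k \<Rightarrow> 0 | Inr l \<Rightarrow> \<sigma> x $ j $ l))"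

lemma sum_module_pack: "sum_module \<rho> \<sigma> x *v pack v w = pack (\<rho> x *v v) (\<sigma> x *v w)"
proof -
  have "(\<Sum>q\<in>UNIV. g q) = (\<Sum>i\<in>UNIV. g (Inl i)) + (\<Sum>j\<in>UNIV. g (Inr j))"
    for g :: "'a + 'b \<Rightarrow> complex"
    by (simp add: UNIV_Plus_UNIV[symmetric] sum.Plus del: UNIV_Plus_UNIV)
  then show ?thesis
    by (simp add: vec_eq_iff pack_def sum_module_def matrix_vector_mult_def split: sum.split)
qed

lemma sum_module_action:
  "pleft (sum_module \<rho> \<sigma> x *v z) = \<rho> x *v pleft z" "pright (sum_module \<rho> \<sigma> x *v z) = \<sigma> x *v pright z"
  using sum_module_pack[of \<rho> \<sigma> x "pleft z" "pright z"] by simp_all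

lemma sl3_module_sum:
  assumes "sl3_module \<rho>" "sl3_module \<sigma>"
  shows "sl3_module (sum_module \<rho> \<sigma>)"
proof (rule sl3_moduleI[of "range (\<lambda>(v, w). pack v w)"])
  have "x \<in> range (\<lambda>(v, w). pack v w)" for x :: "complex^('a + 'b)"
    by (rule image_eqI[of _ _ "(pleft x, pright x)"]) auto
  then have "range (\<lambda>(v, w). pack v w) = (UNIV :: (complex^('a + 'b)) set)"
    by blast
  then show "vec.span (range (\<lambda>(v, w). pack v w)) = (UNIV :: (complex^('a + 'b)) set)"
    by simp
next
  interpret R: sl3_rep \<rho> using assms by unfold_locales
  interpret S: sl3_rep \<sigma> using assms by unfold_locales
  fix x y :: "complex^3^3" and c and z :: "complex^('a + 'b)"
  assume x: "x \<in> sl3" and "z \<in> range (\<lambda>(v, w). pack v w)"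
  then obtain v w where z: "z = pack v w"
    by auto
  show "sum_module \<rho> \<sigma> (mat c ** x) *v z = c *s (sum_module \<rho> \<sigma> x *v z)"
    by (simp only: z sum_module_pack pack_linear R.act_scale[OF x] S.act_scale[OF x])
  assume y: "y \<in> sl3"
  show "sum_module \<rho> \<sigma> (x + y) *v z = sum_module \<rho> \<sigma> x *v z + sum_module \<rho> \<sigma> y *v z"
    by (simp only: z sum_module_pack pack_linear R.act_add[OF x y] S.act_add[OF x y])
  show "sum_module \<rho> \<sigma> (lie_bracket x y) *v z
      = sum_module \<rho> \<sigma> x *v (sum_module \<rho> \<sigma> y *v z) - sum_module \<rho> \<sigma> y *v (sum_module \<rho> \<sigma> x *v z)"
    by (simp add: z sum_module_pack pack_linear R.act_commute[OF x y] S.act_commute[OF x y])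
qed

lemma subspace_imageI:
  fixes g :: "complex^'n \<Rightarrow> complex^'m"
  assumes N: "vec.subspace N" and add: "\<And>x y. g (x + y) = g x + g y" and scale: "\<And>c x. g (c *s x) = c *s g x"
  shows "vec.subspace (g ` N)" "vec.subspace {x \<in> N. g x = 0}"
proof -
  have g0: "g 0 = 0"
    using scale[of 0 0] by simp
  then show "vec.subspace {x \<in> N. g x = 0}"
    using N by (simp add: vec.subspace_def add scale)
  show "vec.subspace (g ` N)"
    unfolding vec.subspace_def
  proof (intro conjI ballI allI)
    show "0 \<in> g ` N"
      using g0 vec.subspace_0[OF N] by (metis image_eqI)
    fix x y c assume "x \<in> g ` N" "y \<in> g ` N"
    then obtain a b where ab: "a \<in> N" "b \<in> N" "x = g a" "y = g b"
      by blast
    show "x + y \<in> g ` N"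
      unfolding ab add[symmetric] using vec.subspace_add[OF N ab(1,2)] by (rule imageI)
    show "c *s x \<in> g ` N"
      unfolding ab scale[symmetric] using vec.subspace_scale[OF N ab(1)] by (rule imageI)
  qed
qed

lemma equivariant_submodules:
  fixes g :: "complex^'n \<Rightarrow> complex^'m"
  assumes N: "submodule \<tau> N" and g: "\<And>x y. g (x + y) = g x + g y" "\<And>c x. g (c *s x) = c *s g x"
    and eq: "\<And>x z. x \<in> sl3 \<Longrightarrow> g (\<tau> x *v z) = \<rho> x *v g z"
  shows "submodule \<rho> (g ` N)" "submodule \<tau> {z \<in> N. g z = 0}"
proof -
  have sub: "vec.subspace N" and act: "\<And>x z. x \<in> sl3 \<Longrightarrow> z \<in> N \<Longrightarrow> \<tau> x *v z \<in> N"
    using N by (auto simp: submodule_def)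
  show "submodule \<rho> (g ` N)"
    unfolding submodule_def
  proof (intro conjI ballI subspace_imageI(1)[OF sub g])
    fix x w assume x: "x \<in> sl3" and "w \<in> g ` N"
    then obtain z where z: "z \<in> N" "w = g z"
      by blast
    then show "\<rho> x *v w \<in> g ` N"
      using act[OF x z(1)] eq[OF x, of z] by force
  qed
  show "submodule \<tau> {z \<in> N. g z = 0}"
    unfolding submodule_def
  proof (intro conjI ballI subspace_imageI(2)[OF sub g])
    fix x z assume x: "x \<in> sl3" and "z \<in> {z \<in> N. g z = 0}"
    then show "\<tau> x *v z \<in> {z \<in> N. g z = 0}"
      using act[OF x] eq[OF x] by simp
  qed
qed

text \<open>
  In the direct sum of the two modules, \<open>pack v w\<close> is a highest weight vector and generates an
  irreducible submodule \<open>N\<close>. The kernels of the two projections on \<open>N\<close> are submodules that miss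
  \<open>pack v w\<close>, hence zero, and the images are non-zero submodules of irreducible modules. So \<open>N\<close> is the
  graph of an isomorphism.
\<close>

theorem isomorphic_by_highest_weight:
  assumes \<rho>: "sl3_module \<rho>" "irreducible_submodule \<rho> UNIV" "sl3_rep.hwv \<rho> \<mu> v"
    and \<sigma>: "sl3_module \<sigma>" "irreducible_submodule \<sigma> W" "w \<in> W" "sl3_rep.hwv \<sigma> \<mu> w"
  shows "isomorphic_to_submodule \<rho> \<sigma> W"
proof -
  interpret R: sl3_rep \<rho> by unfold_locales (fact \<rho>)
  interpret S: sl3_rep \<sigma> by unfold_locales (fact \<sigma>)
  let ?\<tau> = "sum_module \<rho> \<sigma>"
  interpret T: sl3_rep ?\<tau> by unfold_locales (rule sl3_module_sum[OF \<rho>(1) \<sigma>(1)])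
  have v: "v \<noteq> 0" and w: "w \<noteq> 0"
    using \<rho>(3) \<sigma>(4) by (auto simp: R.hwv_def S.hwv_def)
  have "T.hwv \<mu> (pack v w)"
    using \<rho>(3) \<sigma>(4) v unfolding R.hwv_def S.hwv_def T.hwv_def R.wv_def S.wv_def T.wv_def
    by (metis sum_module_pack pack_linear(2,4) pack_simps(1) proj_linear(3))
  define N where "N = T.gen (pack v w)"
  have N: "irreducible_submodule ?\<tau> N" "submodule ?\<tau> N" "pack v w \<in> N"
    unfolding N_def
    by (fact T.irreducible_gen[OF \<open>T.hwv \<mu> (pack v w)\<close>] T.submodule_gen[OF \<open>T.hwv \<mu> (pack v w)\<close>]
        T.gen_base)+
  have NW: "pright z \<in> W" if "z \<in> N" for z
  proof -
    have "submodule ?\<tau> {z. pright z \<in> W}"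
      using \<sigma>(2) by (auto simp: irreducible_submodule_def submodule_def vec.subspace_def sum_module_action)
    then have "N \<subseteq> {z. pright z \<in> W}"
      unfolding N_def by (rule T.gen_minimal) (simp add: \<sigma>(3))
    then show ?thesis
      using that by blast
  qed
  note left = equivariant_submodules[OF N(2), of pleft \<rho>, OF proj_linear(1,2) sum_module_action(1)]
  note right = equivariant_submodules[OF N(2), of pright \<sigma>, OF proj_linear(6,7) sum_module_action(2)]
  have kernels: "{z \<in> N. pleft z = 0} = {0}" "{z \<in> N. pright z = 0} = {0}"
  proof -
    have "pack v w \<notin> {z \<in> N. pleft z = 0}" "pack v w \<notin> {z \<in> N. pright z = 0}"
      using v w by simp_all
    then have "{z \<in> N. pleft z = 0} \<noteq> N" "{z \<in> N. pright z = 0} \<noteq> N"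
      using N(3) by blast+
    then show "{z \<in> N. pleft z = 0} = {0}" "{z \<in> N. pright z = 0} = {0}"
      using N(1) left(2) right(2) unfolding irreducible_submodule_def by blast+
  qed
  have "v \<in> pleft ` N" "w \<in> pright ` N"
    using N(3) by force+
  have surj: "pleft ` N = UNIV"
    using \<rho>(2) left(1) \<open>v \<in> pleft ` N\<close> v unfolding irreducible_submodule_def by blast
  have onto: "pright ` N = W"
    using \<sigma>(2) right(1) \<open>w \<in> pright ` N\<close> w NW unfolding irreducible_submodule_def by blast
  have sub: "vec.subspace N"
    using N(2) by (simp add: submodule_def)
  have inj: "z = z'" if "z \<in> N" "z' \<in> N" "pleft z = pleft z'" for z z'
  proof -
    have "z - z' \<in> {z \<in> N. pleft z = 0}"
      using that vec.subspace_diff[OF sub] by simp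
    then show ?thesis
      unfolding kernels by simp
  qed
  \<comment> \<open>The inverse of the bijective projection of \<open>N\<close> to the first module.\<close>
  define lift where "lift y = (SOME z. z \<in> N \<and> pleft z = y)" for y
  have lift: "lift y \<in> N" "pleft (lift y) = y" for y
  proof -
    have "\<exists>z. z \<in> N \<and> pleft z = y"
      using surj by (metis UNIV_I imageE)
    then have "lift y \<in> N \<and> pleft (lift y) = y"
      unfolding lift_def by (rule someI_ex)
    then show "lift y \<in> N" "pleft (lift y) = y"
      by blast+
  qed
  have lift_eq: "lift (pleft z) = z" if "z \<in> N" for z
    using inj[OF lift(1) that lift(2)] .
  have lin: "Vector_Spaces.linear (*s) (*s) (\<lambda>y. pright (lift y))"
  proof (rule Vector_Spaces.linear_iff[THEN iffD2], intro conjI allI)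
    show "vector_space ((*s) :: complex \<Rightarrow> complex^'a \<Rightarrow> complex^'a)"
         "vector_space ((*s) :: complex \<Rightarrow> complex^'b \<Rightarrow> complex^'b)"
      by unfold_locales
    fix x y c
    have "lift x + lift y = lift (x + y)"
      using lift_eq[OF vec.subspace_add[OF sub lift(1)[of x] lift(1)[of y]]] lift(2) by simp
    then show "pright (lift (x + y)) = pright (lift x) + pright (lift y)"
      by (metis proj_linear(6))
    have "c *s lift x = lift (c *s x)"
      using lift_eq[OF vec.subspace_scale[OF sub lift(1)[of x], of c]] lift(2) by simp
    then show "pright (lift (c *s x)) = c *s pright (lift x)"
      by (metis proj_linear(7))
  qed
  define A where "A = matrix (\<lambda>y. pright (lift y))"
  have A: "A *v y = pright (lift y)" for y
    unfolding A_def by (rule matrix_works[OF lin])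
  have "inj ((*v) A)"
  proof (rule injI)
    fix y y' assume "A *v y = A *v y'"
    then have "lift y - lift y' \<in> {z \<in> N. pright z = 0}"
      using vec.subspace_diff[OF sub lift(1)[of y] lift(1)[of y']] by (simp add: A)
    then have "lift y = lift y'"
      unfolding kernels by simp
    then show "y = y'"
      using lift(2) by metis
  qed
  moreover have "range ((*v) A) = W"
  proof
    show "range ((*v) A) \<subseteq> W"
      using NW lift(1) by (auto simp: A)
    show "W \<subseteq> range ((*v) A)"
    proof
      fix z assume "z \<in> W"
      then obtain x where "x \<in> N" "z = pright x"
        using onto by blast
      then have "z = A *v pleft x"
        by (simp add: A lift_eq)
      then show "z \<in> range ((*v) A)"
        by blast
    qed
  qed
  moreover have "A *v (\<rho> x *v y) = \<sigma> x *v (A *v y)" if "x \<in> sl3" for x y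
  proof -
    have "?\<tau> x *v lift y \<in> N"
      using N(2) lift(1) that by (simp add: submodule_def)
    then have "lift (pleft (?\<tau> x *v lift y)) = ?\<tau> x *v lift y"
      by (rule lift_eq)
    then show ?thesis
      unfolding A by (metis sum_module_action lift(2))
  qed
  ultimately show ?thesis
    unfolding isomorphic_to_submodule_def by blast
qed

section \<open>Tensor products\<close>

definition tens :: "complex^'n \<Rightarrow> complex^'m \<Rightarrow> complex^('n::finite \<times> 'm::finite)" where
  "tens v w = (\<chi> p. v $ fst p * w $ snd p)"

lemma tens_simps [simp]:
  "tens (v + v') w = tens v w + tens v' w" "tens v (w + w') = tens v w + tens v w'"
  "tens (v - v') w = tens v w - tens v' w" "tens v (w - w') = tens v w - tens v w'"
  "tens (c *s v) w = c *s tens v w" "tens v (c *s w) = c *s tens v w"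
  "tens 0 w = 0" "tens v 0 = 0"
  by (simp_all add: tens_def vec_eq_iff algebra_simps)

lemma tensor_module_tens:
  "tensor_module \<rho> \<sigma> x *v tens v w = tens (\<rho> x *v v) w + tens v (\<sigma> x *v w)"
  unfolding tens_def by (rule tensor_module_pure_tensor)

lemma span_tens:
  assumes "vec.span A = UNIV" "vec.span B = UNIV"
  shows "vec.span {tens a b |a b. a \<in> A \<and> b \<in> B} = UNIV"
proof -
  let ?S = "vec.span {tens a b |a b. a \<in> A \<and> b \<in> B}"
  have 1: "tens a w \<in> ?S" if "a \<in> A" for a w
  proof -
    have "w \<in> vec.span B"
      using assms by simp
    then show ?thesis
    proof (induction rule: vec.span_induct_alt)
      case (step c x y)
      then have "tens a x \<in> ?S"
        using that by (intro vec.span_base) blast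
      then show ?case
        using step.IH by (simp add: vec.span_add vec.span_scale)
    qed (simp add: vec.span_zero)
  qed
  have 2: "tens v w \<in> ?S" for v w
  proof -
    have "v \<in> vec.span A"
      using assms by simp
    then show ?thesis
    proof (induction rule: vec.span_induct_alt)
      case (step c x y)
      then show ?case
        using 1 by (simp add: vec.span_add vec.span_scale)
    qed (simp add: vec.span_zero)
  qed
  have "axis p 1 \<in> ?S" for p :: "'a \<times> 'b"
  proof -
    have "axis p 1 = tens (axis (fst p) 1) (axis (snd p) 1 :: complex^'b)"
      by (auto simp: vec_eq_iff tens_def axis_def prod_eq_iff)
    then show ?thesis
      by (simp only: 2)
  qed
  then have "cart_basis \<subseteq> ?S"
    by (auto simp: cart_basis_def)
  then have "vec.span cart_basis \<subseteq> ?S"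
    by (rule vec.span_minimal) simp
  then show ?thesis
    using span_cart_basis by blast
qed

lemma sl3_module_tensor:
  assumes \<rho>: "sl3_module \<rho>" and \<sigma>: "sl3_module \<sigma>"
  shows "sl3_module (tensor_module \<rho> \<sigma>)"
proof (rule sl3_moduleI)
  show "vec.span {tens a b |a b. a \<in> UNIV \<and> b \<in> UNIV} = UNIV"
    by (rule span_tens) simp_all
next
  interpret R: sl3_rep \<rho> using \<rho> by unfold_locales
  interpret S: sl3_rep \<sigma> using \<sigma> by unfold_locales
  let ?\<tau> = "tensor_module \<rho> \<sigma>"
  fix x y :: "complex^3^3" and c and z :: "complex^('a \<times> 'b)"
  assume x: "x \<in> sl3" and "z \<in> {tens a b |a b. a \<in> UNIV \<and> b \<in> UNIV}"
  then obtain v w where z: "z = tens v w"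
    by auto
  show "?\<tau> (mat c ** x) *v z = c *s (?\<tau> x *v z)"
    by (simp add: z tensor_module_tens R.act_scale[OF x] S.act_scale[OF x] vec.scale_right_distrib)
  assume y: "y \<in> sl3"
  show "?\<tau> (x + y) *v z = ?\<tau> x *v z + ?\<tau> y *v z"
    by (simp add: z tensor_module_tens R.act_add[OF x y] S.act_add[OF x y])
  show "?\<tau> (lie_bracket x y) *v z = ?\<tau> x *v (?\<tau> y *v z) - ?\<tau> y *v (?\<tau> x *v z)"
    by (simp add: z tensor_module_tens vec.add R.act_commute[OF x y] S.act_commute[OF x y])
qed

lemma wv_tens:
  assumes \<rho>: "sl3_module \<rho>" and \<sigma>: "sl3_module \<sigma>"
    and v: "sl3_rep.wv \<rho> (a, b) v" and w: "sl3_rep.wv \<sigma> (c, d) w"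
  shows "sl3_rep.wv (tensor_module \<rho> \<sigma>) (a + c, b + d) (tens v w)"
proof -
  note wv_def = sl3_rep.wv_def[OF sl3_rep.intro]
  show ?thesis
    using v w unfolding wv_def[OF \<rho>] wv_def[OF \<sigma>] wv_def[OF sl3_module_tensor[OF \<rho> \<sigma>]]
    by (simp add: tensor_module_tens)
qed

text \<open>
  Evaluation of the second tensor factor at the functional \<open>u\<close>.
\<close>

definition contract :: "complex^'m \<Rightarrow> complex^('n \<times> 'm::finite) \<Rightarrow> complex^'n::finite" where
  "contract u z = (\<chi> i. \<Sum>j\<in>UNIV. z $ (i, j) * u $ j)"

lemma contract_simps [simp]:
  "contract (u + u') z = contract u z + contract u' z" "contract (c *s u) z = c *s contract u z"
  "contract u (z + z') = contract u z + contract u z'" "contract u (c *s z) = c *s contract u z"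
  "contract u (z - z') = contract u z - contract u z'"
  "contract 0 z = 0" "contract u 0 = 0"
  by (simp_all add: contract_def vec_eq_iff algebra_simps sum.distrib sum_subtractf sum_distrib_left)

lemma contract_tens [simp]: "contract u (tens v w) = pairing u w *s v"
  by (simp add: contract_def tens_def pairing_def vec_eq_iff sum_distrib_left sum_distrib_right mult_ac)

text \<open>
  For a vector killed by \<open>x\<close>, this trades the action of \<open>x\<close> on the first factor for the action of its
  transpose on the functional.
\<close>

lemma contract_tensor_module:
  "contract u (tensor_module \<rho> \<sigma> x *v z) = \<rho> x *v contract u z + contract (transpose (\<sigma> x) *v u) z"
proof -
  have "z \<in> vec.span {tens a b |a b. a \<in> UNIV \<and> b \<in> UNIV}"
    by (subst span_tens) simp_all
  then show ?thesis
  proof (induction rule: vec.span_induct_alt)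
    case base
    then show ?case by simp
  next
    case (step c x' y)
    then obtain v w where "x' = tens v w"
      by blast
    then have "contract u (tensor_module \<rho> \<sigma> x *v x') = \<rho> x *v contract u x' + contract (transpose (\<sigma> x) *v u) x'"
      by (simp add: tensor_module_tens vec.scale pairing_transpose del: transpose_matrix_vector)
    then show ?case
      using step.IH by (simp add: vec.add vec.scale vec.scale_right_distrib del: transpose_matrix_vector)
  qed
qed

lemma contract_eq_0D:
  assumes "\<And>u. contract u z = 0"
  shows "z = 0"
proof -
  have "z $ (i, j) = 0" for i j
  proof -
    have "contract (axis j 1) z $ i = z $ (i, j)"
      by (simp add: contract_def axis_def if_distrib [of "\<lambda>c. _ * c"] cong: if_cong)
    then show ?thesis
      using assms by simp
  qed
  then show ?thesis
    by (simp add: vec_eq_iff split_paired_all)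
qed

section \<open>The component of highest weight \<open>(48, 3)\<close>\<close>

locale gaudin_pair = L: sl3_rep \<rho> + M: sl3_rep \<sigma>
  for \<rho> :: "complex^3^3 \<Rightarrow> complex^'n^'n" and \<sigma> :: "complex^3^3 \<Rightarrow> complex^'m^'m" +
  fixes v w u
  assumes irrL: "irreducible_submodule \<rho> UNIV" and hv: "L.hwv (2, 3) v"
    and irrM: "irreducible_submodule \<sigma> UNIV" and hw: "M.hwv (49, 0) w"
    and uw: "pairing u w = 1" and hu: "sl3_rep.hwv (dual_module \<sigma>) (49, 0) u"
begin

sublocale V: sl3_rep "tensor_module \<rho> \<sigma>"
  by unfold_locales (rule sl3_module_tensor[OF L.module M.module])

sublocale D: sl3_rep "dual_module \<sigma>"
  by unfold_locales (rule sl3_module_dual[OF M.module])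

lemma v_rules: "L.e1 v = 0" "L.e2 v = 0" "L.h1 v = 2 *s v" "L.h2 v = 3 *s v" "v \<noteq> 0"
  using hv by (auto simp: L.hwv_def L.wv_def)

lemma w_rules: "M.e1 w = 0" "M.e2 w = 0" "M.h1 w = 49 *s w" "M.h2 w = 0" "M.f2 w = 0"
  using hw M.hwv_zero_f2[OF hw] by (auto simp: M.hwv_def M.wv_def)

text \<open>
  The functional \<open>u\<close> vanishes on everything below the top weight, and the vanishing of the second
  coordinate of \<open>(49, 0)\<close> makes it vanish on the image of \<open>e2\<close>, too.
\<close>

lemma u_rules:
  "transpose (\<sigma> F1) *v u = 0" "transpose (\<sigma> F2) *v u = 0"
  "transpose (\<sigma> H1) *v u = 49 *s u" "transpose (\<sigma> H2) *v u = 0" "transpose (\<sigma> E2) *v u = 0"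
  using hu[unfolded D.hwv_def D.wv_def] D.hwv_zero_f2[OF hu]
  by (simp_all add: dual_module_def del: transpose_matrix_vector)

lemma pairing_u_f: "pairing u (M.f1 y) = 0" "pairing u (M.f2 y) = 0"
  by (simp_all add: u_rules del: transpose_matrix_vector flip: pairing_transpose)

lemmas L_reorder = L.commute_rules(1,2,4,5,10,11,13,14)
lemmas M_reorder = M.commute_rules(1,2,4,5,10,11,13,14)

abbreviation "p \<equiv> L.f1 (L.f2 (L.f1 v))"
abbreviation "q \<equiv> L.f2 (L.f1 (L.f1 v))"

lemma L_table:
  "L.e1 (L.f1 v) = 2 *s v" "L.e1 (L.f2 v) = 0" "L.e2 (L.f1 v) = 0" "L.e2 (L.f2 v) = 3 *s v"
  "L.e1 (L.f1 (L.f1 v)) = 2 *s L.f1 v"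
  "L.e1 (L.f1 (L.f2 v)) = 3 *s L.f2 v" "L.e2 (L.f1 (L.f2 v)) = 3 *s L.f1 v"
  "L.e1 (L.f2 (L.f1 v)) = 2 *s L.f2 v" "L.e2 (L.f2 (L.f1 v)) = 4 *s L.f1 v"
  "L.e1 p = 2 *s L.f1 (L.f2 v) + L.f2 (L.f1 v)" "L.e2 p = 4 *s L.f1 (L.f1 v)"
  "L.e1 q = 2 *s L.f2 (L.f1 v)" "L.e2 q = 5 *s L.f1 (L.f1 v)"
  by (simp_all add: L_reorder v_rules vec.scale vec.add vec.diff) (simp_all add: vec_eq_iff)

lemma M_table:
  "M.e1 (M.f1 w) = 49 *s w" "M.e2 (M.f1 w) = 0"
  "M.e1 (M.f1 (M.f1 w)) = 96 *s M.f1 w" "M.e2 (M.f1 (M.f1 w)) = 0"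
  "M.e1 (M.f2 (M.f1 w)) = 0" "M.e2 (M.f2 (M.f1 w)) = M.f1 w"
  "M.e1 (M.f1 (M.f2 (M.f1 w))) = 48 *s M.f2 (M.f1 w)" "M.e2 (M.f1 (M.f2 (M.f1 w))) = M.f1 (M.f1 w)"
  by (simp_all add: M_reorder w_rules vec.scale vec.add vec.diff) (simp_all add: vec_eq_iff)

lemma f1_v_nonzero: "L.f1 v \<noteq> 0"
  using L_table(1) v_rules(5) by (auto simp: vector_mul_eq_0)

lemma f1_f1_v_nonzero: "L.f1 (L.f1 v) \<noteq> 0"
  using L_table(5) f1_v_nonzero by (auto simp: vector_mul_eq_0)

text \<open>
  The Serre relation: \<open>f1\<close> commutes with \<open>f3 = [f2, f1]\<close>. So \<open>p\<close> and \<open>q\<close> span the weight space of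
  \<open>\<Lambda>1 - 2 \<alpha>1 - \<alpha>2\<close>.
\<close>

lemma serre: "L.f1 (L.f1 (L.f2 v)) = 2 *s p - q"
proof -
  have "L.f3 (L.f1 v) = L.f1 (L.f3 v)"
    by (rule L.commute_rules)
  then show ?thesis
    unfolding L.f3_eq by (simp add: vec.diff vec_eq_iff algebra_simps)
qed

lemma e2_kernel_generator_nonzero: "5 *s p - 4 *s q \<noteq> 0"
proof
  assume "5 *s p - 4 *s q = 0"
  then have "L.e2 (L.e1 (5 *s p - 4 *s q)) = 0"
    by simp
  \<comment> \<open>Applying \<open>e1\<close> and then \<open>e2\<close> leads to a space spanned by \<open>f1 v\<close>.\<close>
  moreover have "L.e2 (L.e1 (5 *s p - 4 *s q)) = 18 *s L.f1 v"
    by (simp add: vec.diff vec.add vec.scale L_table) (simp add: vec_eq_iff)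
  ultimately show False
    using f1_v_nonzero by (simp add: vector_mul_eq_0)
qed

text \<open>
  A singular vector is determined by its contraction with \<open>u\<close>. The functionals \<open>t\<close> with
  \<open>contract t z = 0\<close> are stable under the transposes of \<open>e1\<close> and \<open>e2\<close>, because \<open>z\<close> is killed by both. These
  transposes are the lowering operators of the dual module, which \<open>u\<close> generates, so every contraction
  of \<open>z\<close> vanishes.
\<close>

lemma contract_injective:
  assumes z: "V.e1 z = 0" "V.e2 z = 0" and "contract u z = 0"
  shows "z = 0"
proof -
  define Z where "Z = {t. contract t z = 0}"
  have Z: "vec.subspace Z"
    by (simp add: Z_def vec.subspace_def)
  have step: "transpose (\<sigma> x) *v t \<in> Z" if "tensor_module \<rho> \<sigma> x *v z = 0" "t \<in> Z" for x t
    using contract_tensor_module[of t \<rho> \<sigma> x z] that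
    by (simp add: Z_def del: transpose_matrix_vector)
  have "t \<in> Z" if "D.fword u m n t" for m n t
    using that
  proof induction
    case fword_0
    then show ?case using assms(3) by (simp add: Z_def)
  next
    case (fword_f1 m n t)
    then show ?case
      using step[OF z(1)] by (simp add: dual_module_def del: transpose_matrix_vector)
  next
    case (fword_f2 m n t)
    then show ?case
      using step[OF z(2)] by (simp add: dual_module_def del: transpose_matrix_vector)
  qed
  then have "D.gen u \<subseteq> Z"
    unfolding D.gen_def by (intro vec.span_minimal[OF _ Z]) blast
  moreover have "D.gen u = UNIV"
  proof -
    have "submodule \<sigma> (annihilator (D.gen u))"
      by (rule M.submodule_annihilator[OF D.submodule_gen[OF hu]])
    moreover have "w \<notin> annihilator (D.gen u)"
      using uw D.gen_base[of u] zero_neq_one unfolding annihilator_def by fastforce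
    then have "annihilator (D.gen u) \<noteq> UNIV"
      by blast
    ultimately have ann: "annihilator (D.gen u) = {0}"
      using irrM unfolding irreducible_submodule_def by blast
    have "t \<in> D.gen u" for t
      by (rule double_annihilator[OF D.submoduleD(1)[OF D.submodule_gen[OF hu]]]) (simp add: ann)
    then show ?thesis
      by blast
  qed
  ultimately have "contract t z = 0" for t
    unfolding Z_def by blast
  then show ?thesis
    by (rule contract_eq_0D)
qed

lemma fword_2_1:
  assumes "L.fword v 2 1 x"
  shows "x \<in> vec.span {p, q}"
proof -
  have f00: "y = v" if "L.fword v 0 0 y" for y
    using that by (auto elim: L.fword.cases)
  have f10: "y = L.f1 v" if "L.fword v (Suc 0) 0 y" for y
    using that by cases (auto dest: f00)
  have f01: "y = L.f2 v" if "L.fword v 0 (Suc 0) y" for y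
    using that by cases (auto dest: f00)
  have f20: "y = L.f1 (L.f1 v)" if "L.fword v (Suc (Suc 0)) 0 y" for y
    using that by cases (auto dest: f10)
  have f11: "y = L.f1 (L.f2 v) \<or> y = L.f2 (L.f1 v)" if "L.fword v (Suc 0) (Suc 0) y" for y
    using that by cases (auto dest: f10 f01)
  have "L.fword v (Suc (Suc 0)) (Suc 0) x"
    using assms by (simp add: numeral_2_eq_2)
  then have "x = L.f1 (L.f1 (L.f2 v)) \<or> x = p \<or> x = q"
    by cases (auto dest: f11 f20)
  then show ?thesis
    unfolding serre
    by (auto intro!: vec.span_diff vec.span_scale intro: vec.span_base)
qed

text \<open>
  The contraction lies in the weight space spanned by \<open>p\<close> and \<open>q\<close>, and \<open>e2\<close> kills it. As \<open>e2\<close> maps \<open>p\<close> and \<open>q\<close>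
  to 4 and 5 times the same non-zero vector, a line remains.
\<close>

lemma contract_hwv:
  assumes z: "V.hwv (48, 3) z"
  obtains c where "contract u z = c *s (5 *s p - 4 *s q)"
proof -
  let ?y = "contract u z"
  have zr: "V.h1 z = 48 *s z" "V.h2 z = 3 *s z" "V.e2 z = 0"
    using z by (auto simp: V.hwv_def V.wv_def)
  have "L.h1 ?y = (-1) *s ?y"
  proof -
    have "48 *s ?y = L.h1 ?y + 49 *s ?y"
      using contract_tensor_module[of u \<rho> \<sigma> H1 z] unfolding u_rules zr by simp
    then have "L.h1 ?y = 48 *s ?y - 49 *s ?y"
      by (simp only: eq_diff_eq)
    then show ?thesis
      by (simp add: vec_eq_iff)
  qed
  moreover have "L.h2 ?y = 3 *s ?y"
    using contract_tensor_module[of u \<rho> \<sigma> H2 z] unfolding u_rules zr by simp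
  ultimately have wvy: "L.wv (-1, 3) ?y"
    by (simp only: L.wv_def fst_conv snd_conv)
  have e2y: "L.e2 ?y = 0"
    using contract_tensor_module[of u \<rho> \<sigma> E2 z] unfolding u_rules zr by simp
  have wvv: "L.wv (2, 3) v"
    using hv by (simp add: L.hwv_def)
  have "?y \<in> vec.span {x \<in> L.fwords v. L.wv (-1, 3) x}"
    using L.weight_vector_in_span[OF _ L.fwords_wv[OF wvv] wvy] L.gen_UNIV[OF irrL hv]
    unfolding L.gen_def by blast
  moreover have "{x \<in> L.fwords v. L.wv (-1, 3) x} \<subseteq> vec.span {p, q}"
  proof
    fix x assume "x \<in> {x \<in> L.fwords v. L.wv (-1, 3) x}"
    then obtain m n where x: "L.fword v m n x" "L.wv (-1, 3) x"
      by blast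
    show "x \<in> vec.span {p, q}"
    proof (cases "x = 0")
      case False
      then have "(2 - 2 * of_nat m + of_nat n :: complex, 3 + of_nat m - 2 * of_nat n :: complex) = (-1, 3)"
        using L.wv_unique[OF L.fword_wv[OF x(1) wvv] x(2)] by blast
      then have eqs: "2 - 2 * of_nat m + of_nat n = (-1 :: complex)" "3 + of_nat m - 2 * of_nat n = (3 :: complex)"
        by blast+
      have "of_nat (3 + n) = (of_nat (2 * m) :: complex)"
        using eqs(1) by (simp add: algebra_simps del: of_nat_eq_iff)
      moreover have "of_nat m = (of_nat (2 * n) :: complex)"
        using eqs(2) by (simp add: algebra_simps del: of_nat_eq_iff)
      ultimately have "3 + n = 2 * m" "m = 2 * n"
        unfolding of_nat_eq_iff by blast+
      then have "m = 2" "n = 1"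
        by auto
      then show ?thesis
        using fword_2_1 x(1) by blast
    qed (simp add: vec.span_zero)
  qed
  ultimately have "?y \<in> vec.span {p, q}"
    using vec.span_minimal[OF _ vec.subspace_span] by blast
  then obtain k l where kl: "?y = k *s p + l *s q"
    by (auto simp: vec.span_insert vec.span_singleton algebra_simps)
  have "L.e2 ?y = (4 * k + 5 * l) *s L.f1 (L.f1 v)"
    unfolding kl by (simp add: vec.add vec.scale L_table) (simp add: vec_eq_iff algebra_simps)
  then have "4 * k + 5 * l = 0"
    using e2y f1_f1_v_nonzero vec.scale_eq_0_iff by metis
  then have "l = - (4 / 5) * k"
    by (simp add: field_simps add_eq_0_iff)
  then have "?y = (k / 5) *s (5 *s p - 4 *s q)"
    unfolding kl by (simp add: vec_eq_iff algebra_simps)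
  then show ?thesis
    by (rule that)
qed

lemma hwv_unique:
  assumes z: "V.hwv (48, 3) z" and z': "V.hwv (48, 3) z'"
  obtains c where "z' = c *s z"
proof -
  obtain c c' where c: "contract u z = c *s (5 *s p - 4 *s q)" "contract u z' = c' *s (5 *s p - 4 *s q)"
    using contract_hwv[OF z] contract_hwv[OF z'] by metis
  have E: "V.e1 z = 0" "V.e2 z = 0" "V.e1 z' = 0" "V.e2 z' = 0" "z \<noteq> 0"
    using z z' by (auto simp: V.hwv_def)
  have "c \<noteq> 0"
    using contract_injective[OF E(1,2)] c(1) E(5) by auto
  have "z' - (c' / c) *s z = 0"
  proof (rule contract_injective)
    show "V.e1 (z' - (c' / c) *s z) = 0" "V.e2 (z' - (c' / c) *s z) = 0"
      using E by (simp_all add: vec.diff vec.scale)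
    show "contract u (z' - (c' / c) *s z) = 0"
      using c \<open>c \<noteq> 0\<close> by simp
  qed
  then show ?thesis
    using that[of "c' / c"] by simp
qed

text \<open>
  The solution, up to scale, of the linear system that expresses that \<open>e1\<close> and \<open>e2\<close> kill a combination
  of these seven tensors. They span the weight space, because \<open>f2 w = 0\<close>. The coefficients of \<open>p\<close> and \<open>q\<close>
  are in the ratio 5 to -4 required by \<open>contract_hwv\<close>.
\<close>

definition singular_vector :: "complex^('n \<times> 'm)" where
  "singular_vector =
     980 *s tens p w - 784 *s tens q w
     - 40 *s tens (L.f1 (L.f2 v)) (M.f1 w) + 12 *s tens (L.f2 (L.f1 v)) (M.f1 w)
     + tens (L.f2 v) (M.f1 (M.f1 w)) + 72 *s tens (L.f1 v) (M.f2 (M.f1 w))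
     - 3 *s tens v (M.f1 (M.f2 (M.f1 w)))"

lemma L_weights:
  "L.wv (0, 4) (L.f1 v)" "L.wv (3, 1) (L.f2 v)" "L.wv (1, 2) (L.f1 (L.f2 v))"
  "L.wv (1, 2) (L.f2 (L.f1 v))" "L.wv (-1, 3) p" "L.wv (-1, 3) q"
proof -
  have "L.wv (2, 3) v"
    using hv by (simp add: L.hwv_def)
  note 0 = L.wv_root(3,4)[OF this, simplified]
  note 1 = L.wv_root(3)[OF 0(1), simplified] L.wv_root(4)[OF 0(1), simplified]
    L.wv_root(3)[OF 0(2), simplified]
  note 2 = L.wv_root(4)[OF 1(1), simplified] L.wv_root(3)[OF 1(2), simplified]
  show "L.wv (0, 4) (L.f1 v)" "L.wv (3, 1) (L.f2 v)" "L.wv (1, 2) (L.f1 (L.f2 v))"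
    "L.wv (1, 2) (L.f2 (L.f1 v))" "L.wv (-1, 3) p" "L.wv (-1, 3) q"
    using 0 1 2 by simp_all
qed

lemma M_weights:
  "M.wv (47, 1) (M.f1 w)" "M.wv (45, 2) (M.f1 (M.f1 w))" "M.wv (48, -1) (M.f2 (M.f1 w))"
  "M.wv (46, 0) (M.f1 (M.f2 (M.f1 w)))"
proof -
  have "M.wv (49, 0) w"
    using hw by (simp add: M.hwv_def)
  note 0 = M.wv_root(3)[OF this, simplified]
  note 1 = M.wv_root(3)[OF 0, simplified] M.wv_root(4)[OF 0, simplified]
  note 2 = M.wv_root(3)[OF 1(2), simplified]
  show "M.wv (47, 1) (M.f1 w)" "M.wv (45, 2) (M.f1 (M.f1 w))" "M.wv (48, -1) (M.f2 (M.f1 w))"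
    "M.wv (46, 0) (M.f1 (M.f2 (M.f1 w)))"
    using 0 1 2 by simp_all
qed

lemma hwv_singular_vector: "V.hwv (48, 3) singular_vector"
  unfolding V.hwv_def
proof (intro conjI)
  show "V.e1 singular_vector = 0" "V.e2 singular_vector = 0"
    by (simp_all add: singular_vector_def tensor_module_tens v_rules w_rules L_table M_table
        vec.scale vec.add vec.diff)
      (simp_all add: vec_eq_iff algebra_simps)
  have wv: "L.wv (2, 3) v" "M.wv (49, 0) w"
    using hv hw by (auto simp: L.hwv_def M.hwv_def)
  note tens = wv_tens[OF L.module M.module]
  have "V.wv (48, 3) (tens p w)" "V.wv (48, 3) (tens q w)"
    "V.wv (48, 3) (tens (L.f1 (L.f2 v)) (M.f1 w))" "V.wv (48, 3) (tens (L.f2 (L.f1 v)) (M.f1 w))"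
    "V.wv (48, 3) (tens (L.f2 v) (M.f1 (M.f1 w)))" "V.wv (48, 3) (tens (L.f1 v) (M.f2 (M.f1 w)))"
    "V.wv (48, 3) (tens v (M.f1 (M.f2 (M.f1 w))))"
    using tens[OF L_weights(5) wv(2)] tens[OF L_weights(6) wv(2)] tens[OF L_weights(3) M_weights(1)]
      tens[OF L_weights(4) M_weights(1)] tens[OF L_weights(2) M_weights(2)]
      tens[OF L_weights(1) M_weights(3)] tens[OF wv(1) M_weights(4)] by simp_all
  then have "singular_vector \<in> {z. V.wv (48, 3) z}"
    unfolding singular_vector_def
    by (intro vec.subspace_add[OF V.subspace_wv] vec.subspace_diff[OF V.subspace_wv]
        vec.subspace_scale[OF V.subspace_wv]) simp_all
  then show "V.wv (48, 3) singular_vector"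
    by simp
  have "contract u singular_vector = 196 *s (5 *s p - 4 *s q)"
    by (simp add: singular_vector_def pairing_u_f uw)
  moreover have "196 *s (5 *s p - 4 *s q) \<noteq> 0"
    using e2_kernel_generator_nonzero vec.scale_eq_0_iff[of "196 :: complex" "5 *s p - 4 *s q"] by simp
  ultimately show "singular_vector \<noteq> 0"
    by (metis contract_simps(7))
qed

lemma weighted_tensor: "V.weighted UNIV"
proof -
  have wv: "L.wv (2, 3) v" "M.wv (49, 0) w"
    using hv hw by (auto simp: L.hwv_def M.hwv_def)
  have "vec.span (L.fwords v) = UNIV" "vec.span (M.fwords w) = UNIV"
    using L.gen_UNIV[OF irrL hv] M.gen_UNIV[OF irrM hw] unfolding L.gen_def M.gen_def .
  then have "vec.span {tens a b |a b. a \<in> L.fwords v \<and> b \<in> M.fwords w} = UNIV"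
    by (rule span_tens)
  moreover have "{tens a b |a b. a \<in> L.fwords v \<and> b \<in> M.fwords w} \<subseteq> {z \<in> UNIV. \<exists>\<mu>. V.wv \<mu> z}"
  proof
    fix z assume "z \<in> {tens a b |a b. a \<in> L.fwords v \<and> b \<in> M.fwords w}"
    then obtain a b where z: "z = tens a b" "a \<in> L.fwords v" "b \<in> M.fwords w"
      by blast
    obtain \<mu> \<nu> where "L.wv (fst \<mu>, snd \<mu>) a" "M.wv (fst \<nu>, snd \<nu>) b"
      using L.fwords_wv[OF wv(1) z(2)] M.fwords_wv[OF wv(2) z(3)] by auto
    then show "z \<in> {z \<in> UNIV. \<exists>\<mu>. V.wv \<mu> z}"
      unfolding z(1) using wv_tens[OF L.module M.module] by blast
  qed
  ultimately show ?thesis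
    unfolding V.weighted_def using vec.span_mono by blast
qed

text \<open>
  In a decomposition into irreducibles, the components of \<open>singular_vector\<close> are again killed by \<open>e1\<close> and
  \<open>e2\<close>, so a summand that contains a non-zero component is isomorphic to \<open>\<tau>\<close>. Conversely every summand
  isomorphic to \<open>\<tau>\<close> contains a highest weight vector of weight \<open>(48, 3)\<close>; as these are all proportional,
  two such summands intersect and hence coincide.
\<close>

theorem multiplicity_one:
  assumes \<tau>: "sl3_module \<tau>" "irreducible_submodule \<tau> UNIV" "sl3_rep.hwv \<tau> (48, 3) x"
  shows "has_multiplicity \<tau> (tensor_module \<rho> \<sigma>) 1"
proof -
  interpret T: sl3_rep \<tau> by unfold_locales (fact \<tau>)
  obtain \<W> where dec: "V.direct_decomposition \<W> UNIV"
    using V.complete_reducibility[OF weighted_tensor] by blast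
  then have irr: "\<forall>W\<in>\<W>. irreducible_submodule (tensor_module \<rho> \<sigma>) W"
    and ex1: "\<And>k. \<exists>!t. t \<in> (\<Pi>\<^sub>E W\<in>\<W>. W) \<and> (\<Sum>W\<in>\<W>. t W) = k" and fin: "finite \<W>"
    unfolding V.direct_decomposition_def by blast+
  then have ds: "is_direct_sum \<W>"
    unfolding is_direct_sum_def by blast
  obtain t where t: "t \<in> (\<Pi>\<^sub>E W\<in>\<W>. W)" "(\<Sum>W\<in>\<W>. t W) = singular_vector"
    using ex1 by blast
  have "\<exists>W0\<in>\<W>. t W0 \<noteq> 0"
  proof (rule ccontr)
    assume "\<not> ?thesis"
    then have "(\<Sum>W\<in>\<W>. t W) = 0"
      by (intro sum.neutral) blast
    then show False
      using t(2) hwv_singular_vector by (simp add: V.hwv_def)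
  qed
  then obtain W0 where W0: "W0 \<in> \<W>" "t W0 \<noteq> 0"
    by blast
  have "tensor_module \<rho> \<sigma> x *v t W0 = c *s t W0"
    if "x \<in> sl3" "tensor_module \<rho> \<sigma> x *v singular_vector = c *s singular_vector" for x c
    using V.component_eigenvector[OF dec t(1) _ that(1) W0(1)] that(2) unfolding t(2) by blast
  note comp = this
  have "V.hwv (48, 3) (t W0)"
    using W0(2) comp[of H1 48] comp[of H2 3] comp[of E1 0] comp[of E2 0] hwv_singular_vector
    by (simp add: V.hwv_def V.wv_def)
  moreover have "t W0 \<in> W0"
    using t(1) W0(1) by (rule PiE_mem)
  ultimately have iso: "isomorphic_to_submodule \<tau> (tensor_module \<rho> \<sigma>) W0"
    using isomorphic_by_highest_weight[OF \<tau> V.module] irr W0(1) by blast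
  have hwv_in: "\<exists>z\<in>W. V.hwv (48, 3) z" if "isomorphic_to_submodule \<tau> (tensor_module \<rho> \<sigma>) W" for W
  proof -
    obtain A where A: "inj ((*v) A)" "range ((*v) A) = W"
      "\<And>y z. y \<in> sl3 \<Longrightarrow> A *v (\<tau> y *v z) = tensor_module \<rho> \<sigma> y *v (A *v z)"
      using \<open>isomorphic_to_submodule \<tau> (tensor_module \<rho> \<sigma>) W\<close> unfolding isomorphic_to_submodule_def by blast
    have xr: "x \<noteq> 0" "\<tau> H1 *v x = 48 *s x" "\<tau> H2 *v x = 3 *s x" "\<tau> E1 *v x = 0" "\<tau> E2 *v x = 0"
      using \<tau>(3) by (auto simp: T.hwv_def T.wv_def)
    have "A *v x \<noteq> 0"
      using injD[OF A(1), of x 0] xr(1) by auto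
    then have "V.hwv (48, 3) (A *v x)"
      unfolding V.hwv_def V.wv_def by (simp add: xr vec.scale flip: A(3))
    then show ?thesis
      using A(2) by blast
  qed
  have "W = W0" if W: "W \<in> \<W>" "isomorphic_to_submodule \<tau> (tensor_module \<rho> \<sigma>) W" for W
  proof -
    obtain z z' where z: "z \<in> W0" "V.hwv (48, 3) z" and z': "z' \<in> W" "V.hwv (48, 3) z'"
      using hwv_in[OF iso] hwv_in[OF W(2)] by blast
    obtain c where "z' = c *s z"
      using hwv_unique[OF z(2) z'(2)] .
    moreover have I: "submodule (tensor_module \<rho> \<sigma>) W0" "submodule (tensor_module \<rho> \<sigma>) W"
      using irr W(1) W0(1) by (auto simp: irreducible_submodule_def)
    ultimately have "z' \<in> W \<inter> W0"
      using z'(1) vec.subspace_scale[OF V.submoduleD(1)[OF I(1)] z(1)] by blast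
    moreover have "z' \<noteq> 0"
      using z'(2) by (simp add: V.hwv_def)
    ultimately have "W \<inter> W0 \<noteq> {0}"
      by blast
    moreover have "submodule (tensor_module \<rho> \<sigma>) (W \<inter> W0)"
      by (rule V.submodule_Int[OF I(2,1)])
    ultimately have "W \<inter> W0 = W" "W \<inter> W0 = W0"
      using irr W(1) W0(1) unfolding irreducible_submodule_def by (meson Int_lower1 Int_lower2)+
    then show ?thesis
      by blast
  qed
  then have "{W \<in> \<W>. isomorphic_to_submodule \<tau> (tensor_module \<rho> \<sigma>) W} = {W0}"
    using W0(1) iso by blast
  then have "card {W \<in> \<W>. isomorphic_to_submodule \<tau> (tensor_module \<rho> \<sigma>) W} = 1"
    by simp
  then show ?thesis
    using ds irr unfolding has_multiplicity_def by blast
qed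

end

section \<open>The Bethe Ansatz equation has no solution\<close>

text \<open>
  In terms of \<open>A = t1 + t2\<close> and \<open>B = t1 t2\<close>, the equations for \<open>t1\<close> and \<open>t2\<close> say that a certain cubic polynomial
  is divisible by \<open>(t - t1) (t - t2)\<close>. Together with the equation for \<open>s\<close> they force
  \<open>A = 2 s\<close> or \<open>50 A = 85 s + 1\<close>. The second case leads to \<open>(15 s - 1)\<^sup>2 = 0\<close>, hence to \<open>s = 1/15\<close> and again to
  \<open>A = 2 s\<close>. But then \<open>B = s\<^sup>2\<close>, and the three points \<open>t1\<close>, \<open>t2\<close> and \<open>s\<close> coincide.
\<close>

lemma gaudin_equation_unsolvable:
  fixes t1 t2 s :: complex
  assumes nz: "t1 \<noteq> 0" "t1 - 1 \<noteq> 0" "t2 \<noteq> 0" "t2 - 1 \<noteq> 0" "t1 - t2 \<noteq> 0" "t1 - s \<noteq> 0" "t2 - s \<noteq> 0" "s \<noteq> 0"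
    and eq1: "2 / t1 + 49 / (t1 - 1) - 2 / (t1 - t2) + 1 / (t1 - s) = 0"
    and eq2: "2 / t2 + 49 / (t2 - 1) - 2 / (t2 - t1) + 1 / (t2 - s) = 0"
    and eq3: "3 / s + 1 / (s - t1) + 1 / (s - t2) = 0"
  shows False
proof -
  define A B where "A = t1 + t2" and "B = t1 * t2"
  \<comment> \<open>The remainder \<open>r1 t + r0\<close> of the cubic obtained by clearing denominators, modulo \<open>t\<^sup>2 - A t + B\<close>.\<close>
  define r1 r0 where "r1 = 49 * s * A + A - 2 * s + 102 * B - 50 * A^2"
    and "r0 = 2 * s * A - (100 * s + 4 - 50 * A) * B"
  have cancel: "c / d * d = c" if "d \<noteq> 0" for c d :: complex
    using that by simp
  have clear: "2 * t * (t - 1) * (t - s) =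
      (2 * (t - 1) * (t - s) + 49 * t * (t - s) + t * (t - 1)) * (t - t')"
    if "t \<noteq> 0" "t - 1 \<noteq> 0" "t - t' \<noteq> 0" "t - s \<noteq> 0"
      "2 / t + 49 / (t - 1) - 2 / (t - t') + 1 / (t - s) = 0" for t t'
  proof -
    have "0 = (2 / t + 49 / (t - 1) - 2 / (t - t') + 1 / (t - s)) * (t * (t - 1) * (t - s) * (t - t'))"
      using that(5) by simp
    also have "\<dots> = (2 / t * t) * ((t - 1) * (t - s) * (t - t')) + (49 / (t - 1) * (t - 1)) * (t * (t - s) * (t - t'))
        - (2 / (t - t') * (t - t')) * (t * (t - 1) * (t - s)) + (1 / (t - s) * (t - s)) * (t * (t - 1) * (t - t'))"
      by algebra
    also have "\<dots> = 2 * ((t - 1) * (t - s) * (t - t')) + 49 * (t * (t - s) * (t - t'))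
        - 2 * (t * (t - 1) * (t - s)) + 1 * (t * (t - 1) * (t - t'))"
      by (simp only: cancel[OF that(1)] cancel[OF that(2)] cancel[OF that(3)] cancel[OF that(4)])
    finally show ?thesis by algebra
  qed
  have "r1 * t1 + r0 = 0"
    using clear[OF nz(1,2,5,6) eq1] unfolding r1_def r0_def A_def B_def by algebra
  moreover have "t2 - t1 \<noteq> 0"
    using nz(5) by simp
  then have "r1 * t2 + r0 = 0"
    using clear[OF nz(3,4) _ nz(7) eq2] unfolding r1_def r0_def A_def B_def by algebra
  ultimately have "r1 * (t1 - t2) = 0"
    by algebra
  then have r1: "r1 = 0"
    using nz(5) by simp
  then have r0: "r0 = 0"
    using \<open>r1 * t1 + r0 = 0\<close> by simp
  have "s - t1 \<noteq> 0" "s - t2 \<noteq> 0"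
    using nz(6,7) by auto
  note nz' = this
  have "0 = (3 / s + 1 / (s - t1) + 1 / (s - t2)) * (s * (s - t1) * (s - t2))"
    using eq3 by simp
  also have "\<dots> = (3 / s * s) * ((s - t1) * (s - t2)) + (1 / (s - t1) * (s - t1)) * (s * (s - t2))
      + (1 / (s - t2) * (s - t2)) * (s * (s - t1))"
    by algebra
  also have "\<dots> = 3 * ((s - t1) * (s - t2)) + 1 * (s * (s - t2)) + 1 * (s * (s - t1))"
    by (simp only: cancel[OF nz(8)] cancel[OF nz'(1)] cancel[OF nz'(2)])
  finally have "3 * ((s - t1) * (s - t2)) + s * (s - t2) + s * (s - t1) = 0"
    by simp
  then have AB: "3 * B = 4 * A * s - 5 * s^2"
    unfolding A_def B_def by algebra
  have "(A - 2 * s) * (50 * A - 85 * s - 1) = 0"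
    using r1 AB unfolding r1_def by algebra
  moreover have "50 * A - 85 * s - 1 = 0 \<Longrightarrow> A - 2 * s = 0"
  proof -
    assume A: "50 * A - 85 * s - 1 = 0"
    have "s * ((15 * s - 1)^2) = 0"
      using r0 AB A unfolding r0_def by algebra
    then have "15 * s - 1 = 0"
      using nz(8) by simp
    then show "A - 2 * s = 0"
      using A by algebra
  qed
  ultimately have A: "A = 2 * s"
    by auto
  then have "B = s^2"
    using AB by algebra
  then have "(t1 - t2)^2 = 0"
    using A unfolding A_def B_def by algebra
  then show False
    using nz(5) by simp
qed

theorem proposition6p10:
  fixes \<Lambda>1 \<Lambda>2 \<Lambda>inf :: "complex^3"
  assumes "\<Lambda>1 \<in> cartan_dual" "weight_form \<Lambda>1 alpha1 = 2" "weight_form \<Lambda>1 alpha2 = 3"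
    and "\<Lambda>2 \<in> cartan_dual" "weight_form \<Lambda>2 alpha1 = 49" "weight_form \<Lambda>2 alpha2 = 0"
    and "\<Lambda>inf = \<Lambda>1 + \<Lambda>2 - 2 *s alpha1 - alpha2"
  shows "(\<forall>(L1 :: complex^3^3 \<Rightarrow> complex^'n1^'n1) (L2 :: complex^3^3 \<Rightarrow> complex^'n2^'n2)
            (Linf :: complex^3^3 \<Rightarrow> complex^'n3^'n3).
            irreducible_highest_weight_module L1 \<Lambda>1 \<and>
            irreducible_highest_weight_module L2 \<Lambda>2 \<and>
            irreducible_highest_weight_module Linf \<Lambda>inf \<longrightarrow>
              has_multiplicity Linf (tensor_module L1 L2) 1) \<and>
         \<not> (\<exists>t1 t2 s :: complex.
              t1 \<noteq> 0 \<and> t1 - 1 \<noteq> 0 \<and> t2 \<noteq> 0 \<and> t2 - 1 \<noteq> 0 \<and> t1 - t2 \<noteq> 0 \<and>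
              t1 - s \<noteq> 0 \<and> t2 - s \<noteq> 0 \<and> s \<noteq> 0 \<and>
              2 / t1 + 49 / (t1 - 1) - 2 / (t1 - t2) + 1 / (t1 - s) = 0 \<and>
              2 / t2 + 49 / (t2 - 1) - 2 / (t2 - t1) + 1 / (t2 - s) = 0 \<and>
              3 / s + 1 / (s - t1) + 1 / (s - t2) = 0)"
proof (intro conjI allI impI)
  fix L1 :: "complex^3^3 \<Rightarrow> complex^'n1^'n1" and L2 :: "complex^3^3 \<Rightarrow> complex^'n2^'n2"
    and Linf :: "complex^3^3 \<Rightarrow> complex^'n3^'n3"
  assume L: "irreducible_highest_weight_module L1 \<Lambda>1 \<and>
            irreducible_highest_weight_module L2 \<Lambda>2 \<and>
            irreducible_highest_weight_module Linf \<Lambda>inf"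
  have lin: "weight_form (\<Lambda>1 + \<Lambda>2 - 2 *s alpha1 - alpha2) \<beta> =
      weight_form \<Lambda>1 \<beta> + weight_form \<Lambda>2 \<beta> - 2 * weight_form alpha1 \<beta> - weight_form alpha2 \<beta>" for \<beta>
    by (simp add: weight_form_def sum_3 algebra_simps)
  have "weight_form alpha2 alpha1 = -1"
    using weight_form_simple_roots(3) by (simp add: weight_form_def mult.commute)
  then have inf: "weight_form \<Lambda>inf alpha1 = 48" "weight_form \<Lambda>inf alpha2 = 3"
    using assms by (simp_all add: lin weight_form_simple_roots)
  have mods: "sl3_module L1" "sl3_module L2" "sl3_module Linf"
    and irr: "irreducible_submodule L1 UNIV" "irreducible_submodule L2 UNIV" "irreducible_submodule Linf UNIV"
    using L by (auto simp: irreducible_highest_weight_module_def)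
  obtain v w x where "highest_weight_vector L1 \<Lambda>1 v" "highest_weight_vector L2 \<Lambda>2 w"
    "highest_weight_vector Linf \<Lambda>inf x"
    using L by (auto simp: irreducible_highest_weight_module_def)
  then have top: "sl3_rep.hwv L1 (2, 3) v" "sl3_rep.hwv L2 (49, 0) w" "sl3_rep.hwv Linf (48, 3) x"
    using sl3_rep.highest_weight_vector_iff[OF sl3_rep.intro] mods assms inf by metis+
  obtain u where "pairing u w = 1" "sl3_rep.hwv (dual_module L2) (49, 0) u"
    using sl3_rep.dual_hwv[OF sl3_rep.intro irr(2) top(2)] mods(2) by blast
  then interpret gaudin_pair L1 L2 v w u
    using mods irr top by unfold_locales
  show "has_multiplicity Linf (tensor_module L1 L2) 1"
    by (rule multiplicity_one[OF mods(3) irr(3) top(3)])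
next
  show "\<not> (\<exists>t1 t2 s :: complex.
              t1 \<noteq> 0 \<and> t1 - 1 \<noteq> 0 \<and> t2 \<noteq> 0 \<and> t2 - 1 \<noteq> 0 \<and> t1 - t2 \<noteq> 0 \<and>
              t1 - s \<noteq> 0 \<and> t2 - s \<noteq> 0 \<and> s \<noteq> 0 \<and>
              2 / t1 + 49 / (t1 - 1) - 2 / (t1 - t2) + 1 / (t1 - s) = 0 \<and>
              2 / t2 + 49 / (t2 - 1) - 2 / (t2 - t1) + 1 / (t2 - s) = 0 \<and>
              3 / s + 1 / (s - t1) + 1 / (s - t2) = 0)"
    using gaudin_equation_unsolvable by blast
qed

end
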